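(* Let $\mathbb F$ be a field of characteristic different from $2$ and let $M$ be a square matrix over $\mathbb F$. The following conditions are equivalent: (i) for every nonsingular matrix $S$ over $\mathbb F$ of the same size as $M$, $S^TMS=M$ implies $\det S=1$ (i.e., each isometry of the bilinear space over $\mathbb F$ with scalar product given by $M$ has determinant $1$); (ii) $M$ is not congruent to a matrix of the form $A\oplus B$ with $A$ a square matrix of odd size.
   Context: Two $n\times n$ matrices $A,B$ over $\mathbb F$ are congruent if there is a nonsingular $n\times n$ matrix $S$ over $\mathbb F$ with $S^TAS=B$. In $A\oplus B$ both $A$ and $B$ are square matrices over $\mathbb F$; the summand $B$ is allowed to be empty (of size $0\times 0$). An isometry of a vector space $V$ with bilinear form $\beta:V\times V\to\mathbb F$ is a linear bijection $\mathcal A:V\to V$ with $\beta(\mathcal A x,\mathcal A y)=\beta(x,y)$ for all $x,y\in V$. *)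

theory Defs
  imports "Jordan_Normal_Form.Determinant"
begin

definition congruent_mat :: "'a :: field mat \<Rightarrow> 'a mat \<Rightarrow> bool" where
  "congruent_mat A B \<longleftrightarrow>
    (\<exists>n. A \<in> carrier_mat n n \<and> B \<in> carrier_mat n n \<and>
      (\<exists>S \<in> carrier_mat n n. invertible_mat S \<and> S\<^sup>T * A * S = B))"

definition direct_sum_mat :: "'a :: zero mat \<Rightarrow> 'a mat \<Rightarrow> 'a mat" (infixr "\<oplus>\<^sub>m" 65) where
  "A \<oplus>\<^sub>m B = four_block_mat A (0\<^sub>m (dim_row A) (dim_col B)) (0\<^sub>m (dim_row B) (dim_col A)) B"

end

theory Submission
  imports Defs "Jordan_Normal_Form.Char_Poly"
begin

text \<open>An orthogonal summand of odd size carries the isometry that is \<open>-1\<close> on the summand and \<open>1\<close> on its complement; its determinant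
  is \<open>-1\<close>, which differs from 1 in characteristic other than 2. The work lies in the converse: if the form \<open>M\<close>, which may be degenerate,
  has no orthogonal summand of odd size, then every isometry \<open>S\<close> has determinant 1 (lemma \<open>isometry_det_one\<close>).

  Let \<open>R\<close> be the inverse of \<open>S\<close>. For every polynomial \<open>f\<close> the operators \<open>f(S)\<close> and \<open>f(R)\<close> are adjoint with respect to the form, so \<open>f(S) f(R)\<close> is
  self-adjoint, and its Fitting decomposition into a nilpotent and an invertible part is orthogonal and invariant
  under \<open>S\<close>. Choose for \<open>f\<close> a monic polynomial \<open>p\<close> of least degree with \<open>p(S)\<close> singular; it is prime. By induction on
  the size one may assume that \<open>p(S) p(R)\<close> is nilpotent, and two cases remain.

  If \<open>p(S)\<close> and \<open>p(R)\<close> have a common kernel vector, then \<open>p\<close> is its own reciprocal polynomial up to a scalar, the characteristic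
  polynomial of \<open>S\<close> is a power of \<open>p\<close>, and the determinant can be read off; the size is even because otherwise the whole space would be an odd
  summand (\<open>det_of_self_reciprocal\<close>).

  If not, the Fitting decomposition of \<open>p(S)\<close> is a decomposition into two totally isotropic subspaces
  (\<open>det_of_isotropic_splitting\<close>). When their dimensions agree, \<open>S\<close> and \<open>R\<close> have the same determinant on
  the first and on the second subspace, respectively, and \<open>det S = 1\<close>. When they differ, the form amounts to a pair of non-square matrices up to independent base
  changes on both sides. Every such pair has a direct summand whose numbers of rows and columns differ by an odd number
  (\<open>pencil_splits_oddly\<close>), which is an odd orthogonal summand of the form. This last fact follows from the classification of matrix pencils,
  but it has a short direct proof by reflection: pass from a pair to its cokernel and back.\<close>

section \<open>Block matrix arithmetic\<close>

text \<open>Matrix laws stated with carrier sets have premises whose dimensions do not occur in the conclusion, so the simplifier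
  cannot instantiate them. Their variants below take equations between dimensions as premises; these the
  simplifier discharges by itself, and so it can compute with (nested) block matrices.\<close>

lemma mult_assoc_dim:
  "dim_col A = dim_row B \<Longrightarrow> dim_col B = dim_row C \<Longrightarrow> (A * B) * C = A * (B * (C :: 'a :: semiring_0 mat))"
  by (rule assoc_mult_mat[of _ "dim_row A" "dim_row B" _ "dim_row C" _ "dim_col C"]) auto

lemma mult_one_left_dim: "dim_row A = n \<Longrightarrow> 1\<^sub>m n * A = (A :: 'a :: semiring_1 mat)"
  by (rule left_mult_one_mat[of _ _ "dim_col A"]) auto

lemma mult_one_right_dim: "dim_col A = n \<Longrightarrow> A * 1\<^sub>m n = (A :: 'a :: semiring_1 mat)"
  by (rule right_mult_one_mat[of _ "dim_row A"]) auto

lemma mult_zero_left_dim: "dim_row A = k \<Longrightarrow> 0\<^sub>m n k * A = (0\<^sub>m n (dim_col A) :: 'a :: semiring_0 mat)"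
  by (rule left_mult_zero_mat) auto

lemma mult_zero_right_dim: "dim_col A = k \<Longrightarrow> A * 0\<^sub>m k n = (0\<^sub>m (dim_row A) n :: 'a :: semiring_0 mat)"
  by (rule right_mult_zero_mat) auto

lemma mult_add_left_dim:
  "dim_row A = dim_row B \<Longrightarrow> dim_col A = dim_col B \<Longrightarrow> dim_col B = dim_row C \<Longrightarrow>
    (A + B) * C = A * C + B * (C :: 'a :: semiring_0 mat)"
  by (rule add_mult_distrib_mat[of _ "dim_row A" "dim_col A" _ _ "dim_col C"]) auto

lemma mult_add_right_dim:
  "dim_row C = dim_row B \<Longrightarrow> dim_col C = dim_col B \<Longrightarrow> dim_col A = dim_row B \<Longrightarrow>
    A * (B + C) = A * B + A * (C :: 'a :: semiring_0 mat)"
  by (rule mult_add_distrib_mat[of _ "dim_row A" "dim_col A" _ "dim_col B"]) auto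

lemma transpose_mult_dim:
  "dim_col A = dim_row B \<Longrightarrow> (A * B)\<^sup>T = B\<^sup>T * (A :: 'a :: comm_semiring_0 mat)\<^sup>T"
  by (rule transpose_mult[of _ "dim_row A" "dim_row B" _ "dim_col B"]) auto

lemma add_zero_left_dim: "dim_row A = r \<Longrightarrow> dim_col A = c \<Longrightarrow> 0\<^sub>m r c + A = (A :: 'a :: monoid_add mat)"
  by (rule eq_matI) auto

lemma add_zero_right_dim: "dim_row A = r \<Longrightarrow> dim_col A = c \<Longrightarrow> A + 0\<^sub>m r c = (A :: 'a :: monoid_add mat)"
  by (rule eq_matI) auto

lemma smult_left_dim: "(k :: 'a :: comm_semiring_0) \<cdot>\<^sub>m A * B = k \<cdot>\<^sub>m (A * B)" if "dim_col A = dim_row B"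
  by (rule mult_smult_assoc_mat[of _ "dim_row A" "dim_col A" _ "dim_col B"]) (use that in auto)

lemma smult_right_dim: "A * ((k :: 'a :: comm_semiring_0) \<cdot>\<^sub>m B) = k \<cdot>\<^sub>m (A * B)" if "dim_col A = dim_row B"
  by (rule mult_smult_distrib[of _ "dim_row A" "dim_col A" _ "dim_col B"]) (use that in auto)

lemma block_mult_dim:
  fixes A1 :: "'a :: comm_semiring_0 mat"
  assumes "dim_row B1 = dim_row A1" "dim_col C1 = dim_col A1" "dim_row D1 = dim_row C1" "dim_col D1 = dim_col B1"
    "dim_row A2 = dim_col A1" "dim_row B2 = dim_col A1" "dim_row C2 = dim_col B1" "dim_row D2 = dim_col B1"
    "dim_col C2 = dim_col A2" "dim_col D2 = dim_col B2"
  shows "four_block_mat A1 B1 C1 D1 * four_block_mat A2 B2 C2 D2 =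
    four_block_mat (A1 * A2 + B1 * C2) (A1 * B2 + B1 * D2) (C1 * A2 + D1 * C2) (C1 * B2 + D1 * D2)"
  by (rule mult_four_block_mat[of _ "dim_row A1" "dim_col A1" _ "dim_col B1" _ "dim_row C1" _ _ "dim_col A2" _ "dim_col B2"])
    (use assms in auto)

lemma block_add_dim:
  assumes "dim_row B1 = dim_row A1" "dim_col C1 = dim_col A1" "dim_row D1 = dim_row C1" "dim_col D1 = dim_col B1"
    "dim_row A2 = dim_row A1" "dim_row B2 = dim_row A1" "dim_row C2 = dim_row C1" "dim_row D2 = dim_row C1"
    "dim_col A2 = dim_col A1" "dim_col B2 = dim_col B1" "dim_col C2 = dim_col A1" "dim_col D2 = dim_col B1"
  shows "four_block_mat A1 B1 C1 D1 + four_block_mat A2 B2 C2 D2 =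
    four_block_mat (A1 + A2) (B1 + B2) (C1 + C2) (D1 + D2)"
  by (rule eq_matI) (use assms in auto)

lemma block_transpose_dim:
  assumes "dim_row B = dim_row A" "dim_col C = dim_col A" "dim_row D = dim_row C" "dim_col D = dim_col B"
  shows "(four_block_mat A B C D)\<^sup>T = four_block_mat A\<^sup>T C\<^sup>T B\<^sup>T D\<^sup>T"
  by (rule eq_matI) (use assms in auto)

lemma block_inject_dim:
  assumes "dim_row B = dim_row A" "dim_col C = dim_col A" "dim_row D = dim_row C" "dim_col D = dim_col B"
    "dim_row B' = dim_row A'" "dim_col C' = dim_col A'" "dim_row D' = dim_row C'" "dim_col D' = dim_col B'"
    "dim_row A' = dim_row A" "dim_col A' = dim_col A" "dim_row D' = dim_row D" "dim_col D' = dim_col D"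
  shows "four_block_mat A B C D = four_block_mat A' B' C' D' \<longleftrightarrow> A = A' \<and> B = B' \<and> C = C' \<and> D = D'"
    (is "?L = ?R \<longleftrightarrow> _")
proof
  assume e: "?L = ?R"
  have idx: "?L $$ (i, j) = ?R $$ (i, j)" for i j using e by simp
  have "A = A'"
  proof (rule eq_matI)
    fix i j assume "i < dim_row A'" "j < dim_col A'" then show "A $$ (i, j) = A' $$ (i, j)"
      using idx[of i j] assms by auto
  qed (use assms in auto)
  moreover have "B = B'"
  proof (rule eq_matI)
    fix i j assume "i < dim_row B'" "j < dim_col B'" then show "B $$ (i, j) = B' $$ (i, j)"
      using idx[of i "j + dim_col A"] assms by auto
  qed (use assms in auto)
  moreover have "C = C'"
  proof (rule eq_matI)
    fix i j assume "i < dim_row C'" "j < dim_col C'" then show "C $$ (i, j) = C' $$ (i, j)"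
      using idx[of "i + dim_row A" j] assms by auto
  qed (use assms in auto)
  moreover have "D = D'"
  proof (rule eq_matI)
    fix i j assume "i < dim_row D'" "j < dim_col D'" then show "D $$ (i, j) = D' $$ (i, j)"
      using idx[of "i + dim_row A" "j + dim_col A"] assms by auto
  qed (use assms in auto)
  ultimately show "A = A' \<and> B = B' \<and> C = C' \<and> D = D'" by blast
qed auto

lemma block_split:
  assumes "A \<in> carrier_mat (r1 + r2) (c1 + c2)"
  obtains A11 A12 A21 A22 where "A = four_block_mat A11 A12 A21 A22"
    "A11 \<in> carrier_mat r1 c1" "A12 \<in> carrier_mat r1 c2" "A21 \<in> carrier_mat r2 c1" "A22 \<in> carrier_mat r2 c2"
proof (rule that)
  let ?A11 = "mat r1 c1 (\<lambda>(i, j). A $$ (i, j))" let ?A12 = "mat r1 c2 (\<lambda>(i, j). A $$ (i, j + c1))"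
  let ?A21 = "mat r2 c1 (\<lambda>(i, j). A $$ (i + r1, j))" let ?A22 = "mat r2 c2 (\<lambda>(i, j). A $$ (i + r1, j + c1))"
  show "A = four_block_mat ?A11 ?A12 ?A21 ?A22" by (rule eq_matI) (use assms in auto)
qed auto

lemmas block_simps = mult_assoc_dim mult_one_left_dim mult_one_right_dim mult_zero_left_dim mult_zero_right_dim
  mult_add_left_dim mult_add_right_dim transpose_mult_dim add_zero_left_dim add_zero_right_dim
  block_mult_dim block_add_dim block_transpose_dim block_inject_dim

section \<open>Inverse matrices and injective matrices\<close>

text \<open>The inverse is carried along as a second argument: base changes need it constantly, and products, transposes
  and direct sums of inverse pairs are again explicit inverse pairs.\<close>

definition mutually_inverse :: "nat \<Rightarrow> 'a :: field mat \<Rightarrow> 'a mat \<Rightarrow> bool" where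
  "mutually_inverse n P Q \<longleftrightarrow> P \<in> carrier_mat n n \<and> Q \<in> carrier_mat n n \<and> P * Q = 1\<^sub>m n \<and> Q * P = 1\<^sub>m n"

lemma mutually_inverseD:
  assumes "mutually_inverse n P Q"
  shows "P \<in> carrier_mat n n" "Q \<in> carrier_mat n n" "P * Q = 1\<^sub>m n" "Q * P = 1\<^sub>m n"
    "dim_row P = n" "dim_col P = n" "dim_row Q = n" "dim_col Q = n"
  using assms by (auto simp: mutually_inverse_def)

lemma mutually_inverse_cancel:
  assumes "mutually_inverse n P Q" "dim_row X = n"
  shows "P * (Q * X) = X" "Q * (P * X) = X"
  using mutually_inverseD[OF assms(1)] assms(2)
  by (simp_all flip: mult_assoc_dim add: mult_one_left_dim)

lemma mutually_inverse_sym: "mutually_inverse n P Q \<Longrightarrow> mutually_inverse n Q P"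
  by (auto simp: mutually_inverse_def)

lemma mutually_inverse_one: "mutually_inverse n (1\<^sub>m n) (1\<^sub>m n)"
  by (auto simp: mutually_inverse_def)

lemma mutually_inverse_transpose:
  assumes "mutually_inverse n P Q" shows "mutually_inverse n P\<^sup>T Q\<^sup>T"
  using mutually_inverseD[OF assms]
  by (auto simp: mutually_inverse_def simp flip: transpose_mult_dim)

lemma mutually_inverse_mult:
  assumes "mutually_inverse n P Q" "mutually_inverse n P' Q'" shows "mutually_inverse n (P * P') (Q' * Q)"
  using mutually_inverseD[OF assms(1)] mutually_inverseD[OF assms(2)]
    mutually_inverse_cancel[OF assms(1)] mutually_inverse_cancel[OF assms(2)]
  by (auto simp: mutually_inverse_def mult_assoc_dim)

lemma mutually_inverse_unit_upper:
  assumes "Y \<in> carrier_mat n m"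
  shows "mutually_inverse (n + m) (four_block_mat (1\<^sub>m n) Y (0\<^sub>m m n) (1\<^sub>m m)) (four_block_mat (1\<^sub>m n) (- Y) (0\<^sub>m m n) (1\<^sub>m m))"
proof -
  have "- Y + Y = 0\<^sub>m n m" "Y + - Y = 0\<^sub>m n m" "- 0\<^sub>m m m = (0\<^sub>m m m :: 'a mat)"
    using assms by (auto intro!: eq_matI)
  then show ?thesis using assms by (auto simp: mutually_inverse_def block_simps)
qed

lemma mutually_inverse_unique_det:
  assumes "mutually_inverse n P Q" shows "det P * det Q = 1"
  using mutually_inverseD[OF assms] det_mult[of P n Q] by auto

lemma invertible_mat_iff_mutually_inverse:
  assumes "P \<in> carrier_mat n n"
  shows "invertible_mat P \<longleftrightarrow> (\<exists>Q. mutually_inverse n P Q)"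
proof
  assume "invertible_mat P"
  then obtain Q where Q: "P * Q = 1\<^sub>m n" "Q * P = 1\<^sub>m (dim_row Q)"
    using assms by (auto simp: invertible_mat_def inverts_mat_def)
  have "dim_col Q = n" using arg_cong[OF Q(1), of dim_col] by simp
  moreover have "dim_row Q = n" using arg_cong[OF Q(2), of dim_col] assms by simp
  ultimately show "\<exists>Q. mutually_inverse n P Q" using Q assms unfolding mutually_inverse_def by auto
qed (use assms in \<open>auto simp: mutually_inverse_def invertible_mat_def inverts_mat_def\<close>)

lemma left_inverse_mutually_inverse:
  fixes P :: "'a :: field mat"
  assumes "P \<in> carrier_mat n n" "Q \<in> carrier_mat n n" "P * Q = 1\<^sub>m n"
  shows "mutually_inverse n P Q"
  using assms mat_mult_left_right_inverse[OF assms] by (auto simp: mutually_inverse_def)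

lemma mutually_inverse_if_det: 
  fixes P :: "'a :: field mat"
  assumes "P \<in> carrier_mat n n" "det P \<noteq> 0"
  obtains Q where "mutually_inverse n P Q"
proof -
  from det_non_zero_imp_unit[OF assms, of "undefined :: nat"] 
  obtain Q where "Q \<in> carrier_mat n n" "Q * P = 1\<^sub>m n" "P * Q = 1\<^sub>m n"
    unfolding Units_def ring_mat_def by auto
  then show ?thesis using assms that by (auto simp: mutually_inverse_def)
qed

text \<open>Column vectors are taken to be matrices with one column, so that the same block calculus applies to
  matrices and to vectors.\<close>

definition injective_mat :: "'a :: semiring_0 mat \<Rightarrow> bool" where
  "injective_mat A \<longleftrightarrow> (\<forall>x \<in> carrier_mat (dim_col A) 1. A * x = 0\<^sub>m (dim_row A) 1 \<longrightarrow> x = 0\<^sub>m (dim_col A) 1)"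

lemma injective_mat_iff:
  "A \<in> carrier_mat m n \<Longrightarrow> injective_mat A \<longleftrightarrow> (\<forall>x \<in> carrier_mat n 1. A * x = 0\<^sub>m m 1 \<longrightarrow> x = 0\<^sub>m n 1)"
  by (simp add: injective_mat_def)

lemma injective_mat_invertible:
  fixes A :: "'a :: field mat"
  assumes A: "A \<in> carrier_mat n n" and "injective_mat A"
  obtains B where "mutually_inverse n A B"
proof -
  have "det A \<noteq> 0"
  proof
    assume "det A = 0"
    then obtain v where v: "v \<in> carrier_vec n" "v \<noteq> 0\<^sub>v n" "A *\<^sub>v v = 0\<^sub>v n"
      using det_0_iff_vec_prod_zero_field[OF A] by auto
    define x where "x = mat n 1 (\<lambda>(i, j). v $ i)"
    have cx: "col x 0 = v" using v by (auto simp: x_def)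
    have "A * x = 0\<^sub>m n 1"
    proof (rule eq_matI)
      fix i j assume "i < dim_row (0\<^sub>m n 1 :: 'a mat)" "j < dim_col (0\<^sub>m n 1 :: 'a mat)"
      then have "(A * x) $$ (i, j) = (A *\<^sub>v v) $ i" using A cx by (auto simp: x_def)
      then show "(A * x) $$ (i, j) = 0\<^sub>m n 1 $$ (i, j)" using v \<open>i < _\<close> \<open>j < _\<close> by auto
    qed (use A in \<open>auto simp: x_def\<close>)
    moreover have "x \<in> carrier_mat n 1" by (simp add: x_def)
    ultimately have "x = 0\<^sub>m n 1" using assms unfolding injective_mat_def by auto
    then have "v = 0\<^sub>v n" using cx by auto
    then show False using v by simp
  qed
  from mutually_inverse_if_det[OF A this] that show ?thesis by blast
qed

text \<open>Padding with zero rows gives a square matrix, which cannot be invertible.\<close>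

lemma wide_mat_kernel:
  fixes A :: "'a :: field mat"
  assumes A: "A \<in> carrier_mat m n" and "m < n"
  obtains x where "x \<in> carrier_mat n 1" "x \<noteq> 0\<^sub>m n 1" "A * x = 0\<^sub>m m 1"
proof -
  let ?B = "four_block_mat A (0\<^sub>m m 0) (0\<^sub>m (n - m) n) (0\<^sub>m (n - m) 0)"
  have B: "?B \<in> carrier_mat n n" using assms by auto
  have "\<not> injective_mat ?B"
  proof
    assume "injective_mat ?B"
    then obtain C where C: "mutually_inverse n ?B C" using injective_mat_invertible[OF B] by blast
    have "(?B * C) $$ (n - 1, n - 1) = row ?B (n - 1) \<bullet> col C (n - 1)"
      using mutually_inverseD[OF C] assms by (subst index_mult_mat) auto
    also have "row ?B (n - 1) = 0\<^sub>v n" using assms by (intro eq_vecI) auto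
    also have "0\<^sub>v n \<bullet> col C (n - 1) = 0" using mutually_inverseD(2)[OF C] assms by (intro scalar_prod_left_zero) auto
    finally have "(?B * C) $$ (n - 1, n - 1) = 0" .
    moreover have "(?B * C) $$ (n - 1, n - 1) = 1" 
      unfolding mutually_inverseD(3)[OF C] using assms by simp
    ultimately show False by simp
  qed
  then obtain x where x: "x \<in> carrier_mat n 1" "?B * x = 0\<^sub>m n 1" "x \<noteq> 0\<^sub>m n 1"
    using injective_mat_iff[OF B] by auto
  have "?B * x = ?B * four_block_mat x (0\<^sub>m n 0) (0\<^sub>m 0 1) (0\<^sub>m 0 0)"
    by (rule arg_cong[of _ _ "(*) ?B"]) (rule eq_matI; use x in auto)
  also have "\<dots> = four_block_mat (A * x) (0\<^sub>m m 0) (0\<^sub>m (n - m) 1) (0\<^sub>m (n - m) 0)"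
    using assms x(1) by (subst block_mult_dim) (auto simp: block_simps)
  finally have "four_block_mat (A * x) (0\<^sub>m m 0) (0\<^sub>m (n - m) 1) (0\<^sub>m (n - m) 0) = 
     four_block_mat (0\<^sub>m m 1) (0\<^sub>m m 0) (0\<^sub>m (n - m) 1) (0\<^sub>m (n - m) 0)" using x assms by (auto intro!: eq_matI)
  then have "A * x = 0\<^sub>m m 1" using assms x by (subst (asm) block_inject_dim) auto
  with x that show ?thesis by blast
qed

text \<open>Horizontal and vertical juxtaposition are block matrices whose missing blocks have height or width 0,
  so that the block calculus covers them as well.\<close>

definition hcat :: "'a :: zero mat \<Rightarrow> 'a mat \<Rightarrow> 'a mat" where
  "hcat A B = four_block_mat A B (0\<^sub>m 0 (dim_col A)) (0\<^sub>m 0 (dim_col B))"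

definition vcat :: "'a :: zero mat \<Rightarrow> 'a mat \<Rightarrow> 'a mat" where
  "vcat A B = four_block_mat A (0\<^sub>m (dim_row A) 0) B (0\<^sub>m (dim_row B) 0)"

lemma dim_cat [simp]:
  "dim_row (hcat A B) = dim_row A" "dim_col (hcat A B) = dim_col A + dim_col B"
  "dim_row (vcat A B) = dim_row A + dim_row B" "dim_col (vcat A B) = dim_col A"
  by (simp_all add: hcat_def vcat_def)

lemma zero_width_eq: "dim_row A = r \<Longrightarrow> dim_col A = c \<Longrightarrow> r = 0 \<or> c = 0 \<Longrightarrow> A = 0\<^sub>m r c"
  by (rule eq_matI) auto

lemma hcat_mult_vcat:
  "dim_col A = dim_row C \<Longrightarrow> dim_col B = dim_row D \<Longrightarrow> dim_row A = dim_row B \<Longrightarrow> dim_col C = dim_col D \<Longrightarrow>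
    hcat A B * vcat C D = A * C + B * (D :: 'a :: comm_semiring_0 mat)"
  by (rule eq_matI) (auto simp: hcat_def vcat_def block_simps)

lemma vcat_mult:
  assumes "dim_col A = dim_row C" "dim_col B = dim_row C"
  shows "vcat A B * C = vcat (A * C) (B * (C :: 'a :: comm_semiring_0 mat))"
proof -
  have "vcat A B * C = vcat A B * four_block_mat C (0\<^sub>m (dim_row C) 0) (0\<^sub>m 0 (dim_col C)) (0\<^sub>m 0 0)"
    by (rule arg_cong[of _ _ "(*) (vcat A B)"]) (rule eq_matI; auto)
  also have "\<dots> = vcat (A * C) (B * C)" using assms by (simp add: vcat_def block_simps)
  finally show ?thesis .
qed

lemma mult_hcat:
  assumes "dim_col C = dim_row A" "dim_col C = dim_row B"
  shows "C * hcat A B = hcat (C * A) (C * (B :: 'a :: comm_semiring_0 mat))"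
proof -
  have "C * hcat A B = four_block_mat C (0\<^sub>m (dim_row C) 0) (0\<^sub>m 0 (dim_col C)) (0\<^sub>m 0 0) * hcat A B"
    by (rule arg_cong[of _ _ "\<lambda>x. x * hcat A B"]) (rule eq_matI; auto)
  also have "\<dots> = hcat (C * A) (C * B)" using assms by (simp add: hcat_def block_simps)
  finally show ?thesis .
qed

lemma vcat_mult_hcat:
  "dim_col A = dim_row C \<Longrightarrow> dim_col A = dim_row D \<Longrightarrow> dim_col B = dim_row C \<Longrightarrow>
    vcat A B * hcat C D = four_block_mat (A * C) (A * D) (B * C) (B * (D :: 'a :: comm_semiring_0 mat))"
  by (simp add: hcat_def vcat_def block_simps)

lemma transpose_hcat: "dim_row A = dim_row B \<Longrightarrow> (hcat A B)\<^sup>T = vcat A\<^sup>T B\<^sup>T"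
  by (simp add: hcat_def vcat_def block_simps)

lemma vcat_inject:
  "dim_row A = dim_row A' \<Longrightarrow> dim_col A = dim_col A' \<Longrightarrow> dim_row B = dim_row B' \<Longrightarrow> dim_col B = dim_col B' \<Longrightarrow>
    dim_col A = dim_col B \<Longrightarrow> vcat A B = vcat A' B' \<longleftrightarrow> A = A' \<and> B = B'"
  by (simp add: vcat_def block_simps)

lemma hcat_inject:
  "dim_row A = dim_row A' \<Longrightarrow> dim_col A = dim_col A' \<Longrightarrow> dim_row B = dim_row B' \<Longrightarrow> dim_col B = dim_col B' \<Longrightarrow>
    dim_row A = dim_row B \<Longrightarrow> hcat A B = hcat A' B' \<longleftrightarrow> A = A' \<and> B = B'"
  by (simp add: hcat_def block_simps)

lemma hcat_zero [simp]: "hcat (0\<^sub>m r c) (0\<^sub>m r d) = 0\<^sub>m r (c + d)"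
  by (rule eq_matI) (auto simp: hcat_def)

lemma vcat_zero [simp]: "vcat (0\<^sub>m r c) (0\<^sub>m s c) = 0\<^sub>m (r + s) c"
  by (rule eq_matI) (auto simp: vcat_def)

lemma vcat_split:
  assumes "A \<in> carrier_mat (r1 + r2) c"
  obtains A1 A2 where "A = vcat A1 A2" "A1 \<in> carrier_mat r1 c" "A2 \<in> carrier_mat r2 c"
proof -
  have "A \<in> carrier_mat (r1 + r2) (c + 0)" using assms by simp
  from block_split[OF this] obtain A11 A12 A21 A22 where A: "A = four_block_mat A11 A12 A21 A22"
    "A11 \<in> carrier_mat r1 c" "A12 \<in> carrier_mat r1 0" "A21 \<in> carrier_mat r2 c" "A22 \<in> carrier_mat r2 0" .
  moreover have "A12 = 0\<^sub>m r1 0" "A22 = 0\<^sub>m r2 0" using A by (auto intro: zero_width_eq)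
  ultimately show ?thesis using that[of A11 A21] by (simp add: vcat_def)
qed

lemma hcat_split:
  assumes "A \<in> carrier_mat r (c1 + c2)"
  obtains A1 A2 where "A = hcat A1 A2" "A1 \<in> carrier_mat r c1" "A2 \<in> carrier_mat r c2"
proof -
  have "A \<in> carrier_mat (r + 0) (c1 + c2)" using assms by simp
  from block_split[OF this] obtain A11 A12 A21 A22 where A: "A = four_block_mat A11 A12 A21 A22"
    "A11 \<in> carrier_mat r c1" "A12 \<in> carrier_mat r c2" "A21 \<in> carrier_mat 0 c1" "A22 \<in> carrier_mat 0 c2" .
  moreover have "A21 = 0\<^sub>m 0 c1" "A22 = 0\<^sub>m 0 c2" using A by (auto intro: zero_width_eq)
  ultimately show ?thesis using that[of A11 A12] by (simp add: hcat_def)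
qed

text \<open>Otherwise a preimage of each unit vector would give a matrix \<^term>\<open>X\<close> with more columns than rows
  and \<^term>\<open>A * X = 1\<^sub>m m\<close>, but such an \<^term>\<open>X\<close> has a kernel vector.\<close>

lemma column_outside_range:
  fixes A :: "'a :: field mat"
  assumes A: "A \<in> carrier_mat m n" and "n < m"
  obtains w where "w \<in> carrier_mat m 1" "\<And>x. x \<in> carrier_mat n 1 \<Longrightarrow> A * x \<noteq> w"
proof (rule ccontr)
  assume "\<not> thesis"
  then have "\<forall>w \<in> carrier_mat m 1. \<exists>x \<in> carrier_mat n 1. A * x = w" using that by blast
  then obtain f where f: "\<And>w. w \<in> carrier_mat m 1 \<Longrightarrow> f w \<in> carrier_mat n 1 \<and> A * f w = w" by metis
  define e where "e j = (mat m 1 (\<lambda>(i, k). if i = j then 1 else 0) :: 'a mat)" for j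
  have e: "e j \<in> carrier_mat m 1" for j by (simp add: e_def)
  define X where "X = mat n m (\<lambda>(i, j). f (e j) $$ (i, 0))"
  have AX: "A * X = 1\<^sub>m m"
  proof (rule eq_matI)
    fix i j assume ij: "i < dim_row (1\<^sub>m m :: 'a mat)" "j < dim_col (1\<^sub>m m :: 'a mat)"
    have "col X j = col (f (e j)) 0" using f[OF e, of j] ij by (intro eq_vecI) (auto simp: X_def)
    moreover have "dim_col X = m" "dim_row X = n" "f (e j) \<in> carrier_mat n 1" using f[OF e] by (simp_all add: X_def)
    ultimately have "(A * X) $$ (i, j) = (A * f (e j)) $$ (i, 0)" using A ij by simp
    also have "\<dots> = e j $$ (i, 0)" using f[OF e, of j] by simp
    finally show "(A * X) $$ (i, j) = 1\<^sub>m m $$ (i, j)" using ij by (auto simp: e_def)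
  qed (use A in \<open>auto simp: X_def\<close>)
  have X: "X \<in> carrier_mat n m" by (simp add: X_def)
  obtain y where y: "y \<in> carrier_mat m 1" "y \<noteq> 0\<^sub>m m 1" "X * y = 0\<^sub>m n 1"
    using wide_mat_kernel[OF X \<open>n < m\<close>] .
  have "y = (A * X) * y" using AX y(1) by (simp add: mult_one_left_dim)
  also have "\<dots> = A * (X * y)" using A X y(1) by (simp add: mult_assoc_dim)
  also have "\<dots> = 0\<^sub>m m 1" using y A by (simp add: mult_zero_right_dim)
  finally show False using y by simp
qed

text \<open>An injective matrix can be completed to an invertible one, \<open>[A C]\<close> with inverse \<open>[Q1; Q2]\<close>: as long as columns
  are missing, a column outside the range keeps the matrix injective. The conclusion lists the block equations
  of the two matrices being mutually inverse, because later each block is used separately.\<close>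

lemma injective_mat_completion_aux:
  fixes A :: "'a :: field mat"
  assumes "A \<in> carrier_mat (n + k) n" "injective_mat A"
  shows "\<exists>C Q1 Q2. C \<in> carrier_mat (n + k) k \<and> Q1 \<in> carrier_mat n (n + k) \<and> Q2 \<in> carrier_mat k (n + k) \<and>
    Q1 * A = 1\<^sub>m n \<and> Q1 * C = 0\<^sub>m n k \<and> Q2 * A = 0\<^sub>m k n \<and> Q2 * C = 1\<^sub>m k \<and> A * Q1 + C * Q2 = 1\<^sub>m (n + k)"
  using assms
proof (induction k arbitrary: n A)
  case 0
  then obtain B where B: "mutually_inverse n A B" using injective_mat_invertible by auto
  note B = mutually_inverseD[OF B]
  show ?case
    by (rule exI[of _ "0\<^sub>m n 0"], rule exI[of _ B], rule exI[of _ "0\<^sub>m 0 n"])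
      (use B in \<open>auto simp: block_simps intro!: zero_width_eq\<close>)
next
  case (Suc k)
  note A = Suc.prems(1)
  obtain w where w: "w \<in> carrier_mat (n + Suc k) 1" "\<And>x. x \<in> carrier_mat n 1 \<Longrightarrow> A * x \<noteq> w"
    using column_outside_range[OF A] by auto
  have A': "hcat A w \<in> carrier_mat (Suc n + k) (Suc n)" using A w by auto
  have "injective_mat (hcat A w)"
    unfolding injective_mat_iff[OF A']
  proof (intro ballI impI)
    fix z assume z: "z \<in> carrier_mat (Suc n) 1" "hcat A w * z = 0\<^sub>m (Suc n + k) 1"
    then have "z \<in> carrier_mat (n + 1) 1" by simp
    from vcat_split[OF this] obtain z1 z2 where zz: "z = vcat z1 z2" "z1 \<in> carrier_mat n 1" "z2 \<in> carrier_mat 1 1" .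
    define c where "c = z2 $$ (0, 0)"
    have wz: "w * z2 = c \<cdot>\<^sub>m w" 
      by (rule eq_matI) (use w(1) zz in \<open>auto simp: c_def scalar_prod_def\<close>)
    have eq: "A * z1 + c \<cdot>\<^sub>m w = 0\<^sub>m (Suc n + k) 1"
      using z zz A w(1) by (simp add: hcat_mult_vcat wz)
    have "c = 0"
    proof (rule ccontr)
      assume c: "c \<noteq> 0"
      have "(A * z1) $$ (i, 0) + c * w $$ (i, 0) = 0" if "i < Suc n + k" for i
        using arg_cong[OF eq, of "\<lambda>X. X $$ (i, 0)"] that A w(1) zz by simp
      then have *: "w $$ (i, 0) = (- 1 / c) * (A * z1) $$ (i, 0)" if "i < Suc n + k" for i
        using that c by (simp add: field_simps) (metis add.commute eq_neg_iff_add_eq_0 minus_equation_iff)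
      have "A * ((- 1 / c) \<cdot>\<^sub>m z1) = (- 1 / c) \<cdot>\<^sub>m (A * z1)" using A zz by (simp add: smult_right_dim)
      also have "\<dots> = w"
        by (rule eq_matI) (use w(1) zz A * in \<open>auto simp del: index_mult_mat(1)\<close>)
      finally show False using w(2)[of "(- 1 / c) \<cdot>\<^sub>m z1"] zz by simp
    qed
    then have "z2 = 0\<^sub>m 1 1" using zz by (auto intro!: eq_matI simp: c_def)
    moreover have "A * z1 = 0\<^sub>m (n + Suc k) 1"
    proof -
      have "c \<cdot>\<^sub>m w = 0\<^sub>m (Suc n + k) 1" using w(1) \<open>c = 0\<close> by (auto intro!: eq_matI)
      then show ?thesis using eq A zz by (simp add: add_zero_right_dim)
    qed
    then have "z1 = 0\<^sub>m n 1" using Suc.prems(2) zz unfolding injective_mat_iff[OF A] by auto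
    ultimately show "z = 0\<^sub>m (Suc n) 1" using zz by simp
  qed
  from Suc.IH[OF A' this] obtain C Q1 Q2 where C: "C \<in> carrier_mat (Suc n + k) k"
    and Q1: "Q1 \<in> carrier_mat (n + 1) (Suc n + k)" and Q2: "Q2 \<in> carrier_mat k (Suc n + k)"
    and eqs: "Q1 * hcat A w = 1\<^sub>m (n + 1)" "Q1 * C = 0\<^sub>m (n + 1) k" "Q2 * hcat A w = 0\<^sub>m k (n + 1)" "Q2 * C = 1\<^sub>m k"
      "hcat A w * Q1 + C * Q2 = 1\<^sub>m (Suc n + k)" by auto
  from vcat_split[OF Q1] obtain R1 R2 where R: "Q1 = vcat R1 R2" "R1 \<in> carrier_mat n (Suc n + k)"
    "R2 \<in> carrier_mat 1 (Suc n + k)" .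
  have RA: "R1 * A = 1\<^sub>m n" "R1 * w = 0\<^sub>m n 1" "R2 * A = 0\<^sub>m 1 n" "R2 * w = 1\<^sub>m 1"
    using eqs(1) R A w(1) unfolding four_block_one_mat[symmetric]
    by (simp_all add: vcat_mult_hcat block_inject_dim del: four_block_one_mat)
  have RC: "R1 * C = 0\<^sub>m n k" "R2 * C = 0\<^sub>m 1 k"
    using eqs(2) R C unfolding vcat_zero[symmetric] by (simp_all add: vcat_mult vcat_inject del: vcat_zero)
  have QA: "Q2 * A = 0\<^sub>m k n" "Q2 * w = 0\<^sub>m k 1"
    using eqs(3) Q2 A w(1) unfolding hcat_zero[symmetric] by (simp_all add: mult_hcat hcat_inject del: hcat_zero)
  have sum: "A * R1 + (w * R2 + C * Q2) = 1\<^sub>m (n + Suc k)"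
    using eqs(5) R A w(1) C Q2
    by (simp add: hcat_mult_vcat) (subst (asm) assoc_add_mat[of _ "Suc (n + k)" "Suc (n + k)"]; auto)
  have 1: "R1 * hcat w C = 0\<^sub>m n (Suc k)"
    using RA RC R w(1) C by (simp add: mult_hcat)
  have 2: "vcat R2 Q2 * A = 0\<^sub>m (Suc k) n"
    using RA QA R Q2 A by (simp add: vcat_mult)
  have 3: "vcat R2 Q2 * hcat w C = 1\<^sub>m (Suc k)"
    using RA RC QA eqs(4) R Q2 w(1) C four_block_one_mat[of 1 k] by (simp add: vcat_mult_hcat)
  have 4: "A * R1 + hcat w C * vcat R2 Q2 = 1\<^sub>m (n + Suc k)"
    using sum R Q2 w(1) C by (simp add: hcat_mult_vcat)
  \<comment> \<open>the new column moves from the left factor to the complement, and the last row of Q1 moves to Q2\<close>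
  show ?case
    by (rule exI[of _ "hcat w C"], rule exI[of _ R1], rule exI[of _ "vcat R2 Q2"])
      (use 1 2 3 4 RA R Q2 w(1) C in auto)
qed

lemma injective_mat_completion:
  fixes A :: "'a :: field mat"
  assumes A: "A \<in> carrier_mat m n" and "injective_mat A"
  obtains C Q1 Q2 where "n \<le> m" "C \<in> carrier_mat m (m - n)" "Q1 \<in> carrier_mat n m" "Q2 \<in> carrier_mat (m - n) m"
    "Q1 * A = 1\<^sub>m n" "Q1 * C = 0\<^sub>m n (m - n)" "Q2 * A = 0\<^sub>m (m - n) n" "Q2 * C = 1\<^sub>m (m - n)" "A * Q1 + C * Q2 = 1\<^sub>m m"
proof -
  have "n \<le> m"
  proof (rule ccontr)
    assume "\<not> n \<le> m"
    then obtain x where "x \<in> carrier_mat n 1" "x \<noteq> 0\<^sub>m n 1" "A * x = 0\<^sub>m m 1" using wide_mat_kernel[OF A] by auto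
    then show False using assms(2) unfolding injective_mat_iff[OF A] by auto
  qed
  then obtain k where m: "m = n + k" using le_Suc_ex by blast
  show ?thesis using injective_mat_completion_aux[of A n k] A assms(2) that unfolding m by auto
qed

lemma column_extends_to_basis:
  fixes v :: "'a :: field mat"
  assumes v: "v \<in> carrier_mat (Suc n) 1" "v \<noteq> 0\<^sub>m (Suc n) 1"
  obtains C P where "C \<in> carrier_mat (Suc n) n" "mutually_inverse (Suc n) (hcat v C) P"
proof -
  have "\<exists>i < Suc n. v $$ (i, 0) \<noteq> 0"
  proof (rule ccontr)
    assume "\<not> (\<exists>i < Suc n. v $$ (i, 0) \<noteq> 0)"
    then have "v = 0\<^sub>m (Suc n) 1" using v(1) by (intro eq_matI) auto
    then show False using v(2) by simp
  qed
  then obtain i where i: "i < Suc n" "v $$ (i, 0) \<noteq> 0" by blast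
  have "injective_mat v"
    unfolding injective_mat_iff[OF v(1)]
  proof (intro ballI impI)
    fix x :: "'a mat" assume x: "x \<in> carrier_mat 1 1" "v * x = 0\<^sub>m (Suc n) 1"
    have "(v * x) $$ (i, 0) = v $$ (i, 0) * x $$ (0, 0)" using v x(1) i by (simp add: scalar_prod_def)
    then have "x $$ (0, 0) = 0" using x i by simp
    then show "x = 0\<^sub>m 1 1" using x by (auto intro!: eq_matI)
  qed
  from injective_mat_completion[OF v(1) this] obtain C Q1 Q2 where
    C: "C \<in> carrier_mat (Suc n) n" "Q1 \<in> carrier_mat 1 (Suc n)" "Q2 \<in> carrier_mat n (Suc n)"
    and e: "Q1 * v = 1\<^sub>m 1" "Q1 * C = 0\<^sub>m 1 n" "Q2 * v = 0\<^sub>m n 1" "Q2 * C = 1\<^sub>m n" "v * Q1 + C * Q2 = 1\<^sub>m (Suc n)" by auto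
  have "mutually_inverse (Suc n) (hcat v C) (vcat Q1 Q2)"
    using C e v(1) four_block_one_mat[of 1 n] by (auto simp: mutually_inverse_def hcat_mult_vcat vcat_mult_hcat)
  with C that show ?thesis by blast
qed

lemma direct_sum_dim [simp]:
  "dim_row (A \<oplus>\<^sub>m B) = dim_row A + dim_row B" "dim_col (A \<oplus>\<^sub>m B) = dim_col A + dim_col B"
  by (simp_all add: direct_sum_mat_def)

lemma direct_sum_mult:
  "dim_col A = dim_row C \<Longrightarrow> dim_col B = dim_row D \<Longrightarrow>
    (A \<oplus>\<^sub>m B) * (C \<oplus>\<^sub>m D) = (A * C) \<oplus>\<^sub>m (B * (D :: 'a :: comm_semiring_0 mat))"
  by (simp add: direct_sum_mat_def block_simps)

lemma direct_sum_add:
  "dim_row A = dim_row C \<Longrightarrow> dim_col A = dim_col C \<Longrightarrow> dim_row B = dim_row D \<Longrightarrow> dim_col B = dim_col D \<Longrightarrow>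
    (A \<oplus>\<^sub>m B) + (C \<oplus>\<^sub>m D) = (A + C) \<oplus>\<^sub>m (B + (D :: 'a :: comm_semiring_0 mat))"
  by (simp add: direct_sum_mat_def block_simps)

lemma direct_sum_transpose: "(A \<oplus>\<^sub>m B)\<^sup>T = A\<^sup>T \<oplus>\<^sub>m B\<^sup>T"
  by (simp add: direct_sum_mat_def block_simps)

lemma direct_sum_inject:
  "dim_row A = dim_row C \<Longrightarrow> dim_col A = dim_col C \<Longrightarrow> dim_row B = dim_row D \<Longrightarrow> dim_col B = dim_col D \<Longrightarrow>
    A \<oplus>\<^sub>m B = C \<oplus>\<^sub>m D \<longleftrightarrow> A = C \<and> B = D"
  by (simp add: direct_sum_mat_def block_simps)

lemma direct_sum_one [simp]: "1\<^sub>m n \<oplus>\<^sub>m 1\<^sub>m m = 1\<^sub>m (n + m)"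
  by (simp add: direct_sum_mat_def)

lemma direct_sum_zero [simp]: "0\<^sub>m r c \<oplus>\<^sub>m 0\<^sub>m s d = 0\<^sub>m (r + s) (c + d)"
  by (simp add: direct_sum_mat_def)

lemma direct_sum_mult_vcat:
  "dim_col A = dim_row C \<Longrightarrow> dim_col B = dim_row D \<Longrightarrow> dim_col C = dim_col D \<Longrightarrow>
    (A \<oplus>\<^sub>m B) * vcat C D = vcat (A * C) (B * (D :: 'a :: comm_semiring_0 mat))"
  by (simp add: direct_sum_mat_def vcat_def block_simps)

lemma mutually_inverse_direct_sum:
  "mutually_inverse n P Q \<Longrightarrow> mutually_inverse m P' Q' \<Longrightarrow> mutually_inverse (n + m) (P \<oplus>\<^sub>m P') (Q \<oplus>\<^sub>m Q')"
  by (auto simp: mutually_inverse_def direct_sum_mult)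

section \<open>Pairs of rectangular matrices\<close>

text \<open>A pair of \<open>q \<times> p\<close> matrices is a representation of the Kronecker quiver: two linear maps from a
  \<open>p\<close>-dimensional to a \<open>q\<close>-dimensional space. Joint injectivity says that the two kernels meet trivially, that is,
  that \<open>[A; B]\<close> is injective.\<close>

definition jointly_injective :: "'a :: semiring_0 mat \<Rightarrow> 'a mat \<Rightarrow> bool" where
  "jointly_injective A B \<longleftrightarrow> (\<forall>x \<in> carrier_mat (dim_col A) 1.
    A * x = 0\<^sub>m (dim_row A) 1 \<longrightarrow> B * x = 0\<^sub>m (dim_row B) 1 \<longrightarrow> x = 0\<^sub>m (dim_col A) 1)"

lemma jointly_injectiveD:
  "jointly_injective A B \<Longrightarrow> A \<in> carrier_mat q p \<Longrightarrow> B \<in> carrier_mat q p \<Longrightarrow> x \<in> carrier_mat p 1 \<Longrightarrow>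
    A * x = 0\<^sub>m q 1 \<Longrightarrow> B * x = 0\<^sub>m q 1 \<Longrightarrow> x = 0\<^sub>m p 1"
  by (auto simp: jointly_injective_def)

lemma jointly_injective_vcat:
  fixes A :: "'a :: field mat"
  assumes "A \<in> carrier_mat q p" "B \<in> carrier_mat q p" "jointly_injective A B"
  shows "injective_mat (vcat A B)"
  unfolding injective_mat_def
proof (intro ballI impI)
  fix x assume x: "x \<in> carrier_mat (dim_col (vcat A B)) 1" "vcat A B * x = 0\<^sub>m (dim_row (vcat A B)) 1"
  then have "vcat (A * x) (B * x) = vcat (0\<^sub>m q 1) (0\<^sub>m q 1)" using assms by (auto simp: vcat_mult[of A x B])
  then have "A * x = 0\<^sub>m q 1 \<and> B * x = 0\<^sub>m q 1" using assms x(1) by (subst (asm) vcat_inject) auto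
  then show "x = 0\<^sub>m (dim_col (vcat A B)) 1" using jointly_injectiveD[OF assms(3,1,2), of x] x(1) assms by simp
qed

lemma jointly_injective_square:
  fixes A :: "'a :: field mat"
  assumes "A \<in> carrier_mat q p" "B \<in> carrier_mat q p" "R \<in> carrier_mat p p" "jointly_injective (A * R) (B * R)"
  shows "injective_mat R"
  unfolding injective_mat_iff[OF assms(3)]
proof (intro ballI impI)
  fix x assume "x \<in> carrier_mat p 1" "R * x = 0\<^sub>m p 1"
  then show "x = 0\<^sub>m p 1"
    using jointly_injectiveD[OF assms(4), of q p x] assms by (auto simp: block_simps)
qed

lemma jointly_injective_direct_sum:
  fixes A1 :: "'a :: field mat"
  assumes "A1 \<in> carrier_mat q1 p1" "B1 \<in> carrier_mat q1 p1" "A2 \<in> carrier_mat q2 p2" "B2 \<in> carrier_mat q2 p2"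
  shows "jointly_injective (A1 \<oplus>\<^sub>m A2) (B1 \<oplus>\<^sub>m B2) \<longleftrightarrow> jointly_injective A1 B1 \<and> jointly_injective A2 B2"
    (is "?L \<longleftrightarrow> ?R")
proof
  assume L: ?L
  have *: "vcat x1 x2 = 0\<^sub>m (p1 + p2) 1" 
    if "x1 \<in> carrier_mat p1 1" "x2 \<in> carrier_mat p2 1" "A1 * x1 = 0\<^sub>m q1 1" "B1 * x1 = 0\<^sub>m q1 1" 
      "A2 * x2 = 0\<^sub>m q2 1" "B2 * x2 = 0\<^sub>m q2 1" for x1 x2
    by (rule jointly_injectiveD[OF L, of "q1 + q2"]) (use that assms in \<open>auto simp: direct_sum_mult_vcat\<close>)
  have "x1 = 0\<^sub>m p1 1" if "x1 \<in> carrier_mat p1 1" "A1 * x1 = 0\<^sub>m q1 1" "B1 * x1 = 0\<^sub>m q1 1" for x1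
    using *[OF that(1) _ that(2,3), of "0\<^sub>m p2 1"] assms that(1)
    unfolding vcat_zero[symmetric] by (simp add: vcat_inject mult_zero_right_dim del: vcat_zero)
  moreover have "x2 = 0\<^sub>m p2 1" if "x2 \<in> carrier_mat p2 1" "A2 * x2 = 0\<^sub>m q2 1" "B2 * x2 = 0\<^sub>m q2 1" for x2
    using *[OF _ that(1) _ _ that(2,3), of "0\<^sub>m p1 1"] assms that(1)
    unfolding vcat_zero[symmetric] by (simp add: vcat_inject mult_zero_right_dim del: vcat_zero)
  ultimately show ?R using assms by (auto simp: jointly_injective_def)
next
  assume R: ?R
  show ?L
    unfolding jointly_injective_def
  proof (intro ballI impI)
    fix x assume x: "x \<in> carrier_mat (dim_col (A1 \<oplus>\<^sub>m A2)) 1" 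
      "(A1 \<oplus>\<^sub>m A2) * x = 0\<^sub>m (dim_row (A1 \<oplus>\<^sub>m A2)) 1" "(B1 \<oplus>\<^sub>m B2) * x = 0\<^sub>m (dim_row (B1 \<oplus>\<^sub>m B2)) 1"
    then have "x \<in> carrier_mat (p1 + p2) 1" using assms by simp
    from vcat_split[OF this] obtain x1 x2 where xx: "x = vcat x1 x2" "x1 \<in> carrier_mat p1 1" "x2 \<in> carrier_mat p2 1" .
    have "A1 * x1 = 0\<^sub>m q1 1 \<and> A2 * x2 = 0\<^sub>m q2 1"
      using x(2) xx assms unfolding xx(1) by (simp add: direct_sum_mult_vcat vcat_inject del: vcat_zero flip: vcat_zero)
    moreover have "B1 * x1 = 0\<^sub>m q1 1 \<and> B2 * x2 = 0\<^sub>m q2 1"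
      using x(3) xx assms unfolding xx(1) by (simp add: direct_sum_mult_vcat vcat_inject del: vcat_zero flip: vcat_zero)
    ultimately have "x1 = 0\<^sub>m p1 1" "x2 = 0\<^sub>m p2 1"
      using R assms xx jointly_injectiveD[of A1 B1 q1 p1 x1] jointly_injectiveD[of A2 B2 q2 p2 x2] by auto
    then show "x = 0\<^sub>m (dim_col (A1 \<oplus>\<^sub>m A2)) 1" using xx assms by simp
  qed
qed

text \<open>The reflection functor: if \<open>[A; B]\<close> embeds \<open>F\<^sup>p\<close> into \<open>F\<^sup>q \<oplus> F\<^sup>q\<close>, the projection \<open>[D1 D2]\<close> onto the cokernel
  is again a pair of matrices, now from dimension \<open>q\<close> to dimension \<open>2 q - p\<close>. Surjectivity of the projection is
  expressed by joint injectivity of the transposes; the last conclusion is exactness in the middle.\<close>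

lemma cokernel_pair:
  fixes A :: "'a :: field mat"
  assumes A: "A \<in> carrier_mat q p" and B: "B \<in> carrier_mat q p" and inj: "jointly_injective A B"
  obtains D1 D2 where "p \<le> q + q" "D1 \<in> carrier_mat (q + q - p) q" "D2 \<in> carrier_mat (q + q - p) q"
    "D1 * A + D2 * B = 0\<^sub>m (q + q - p) p" "jointly_injective D1\<^sup>T D2\<^sup>T"
    "\<And>K L r. K \<in> carrier_mat q r \<Longrightarrow> L \<in> carrier_mat q r \<Longrightarrow> D1 * K + D2 * L = 0\<^sub>m (q + q - p) r \<Longrightarrow>
      \<exists>R \<in> carrier_mat p r. K = A * R \<and> L = B * R"
proof -
  let ?z = "q + q - p"
  have V: "vcat A B \<in> carrier_mat (q + q) p" using A B by auto
  obtain C Q1 Q2 where le: "p \<le> q + q" and C: "C \<in> carrier_mat (q + q) ?z" and Q1: "Q1 \<in> carrier_mat p (q + q)"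
    and Q2: "Q2 \<in> carrier_mat ?z (q + q)" and e: "Q1 * vcat A B = 1\<^sub>m p" "Q2 * vcat A B = 0\<^sub>m ?z p" "Q2 * C = 1\<^sub>m ?z"
      "vcat A B * Q1 + C * Q2 = 1\<^sub>m (q + q)"
    using injective_mat_completion[OF V jointly_injective_vcat[OF A B inj]] by metis
  from hcat_split[OF Q2] obtain D1 D2 where D: "Q2 = hcat D1 D2" "D1 \<in> carrier_mat ?z q" "D2 \<in> carrier_mat ?z q" .
  have 1: "D1 * A + D2 * B = 0\<^sub>m ?z p" using e(2) D A B by (simp add: hcat_mult_vcat)
  have 2: "jointly_injective D1\<^sup>T D2\<^sup>T"
    unfolding jointly_injective_def
  proof (intro ballI impI)
    fix y assume y: "y \<in> carrier_mat (dim_col D1\<^sup>T) 1" "D1\<^sup>T * y = 0\<^sub>m (dim_row D1\<^sup>T) 1" "D2\<^sup>T * y = 0\<^sub>m (dim_row D2\<^sup>T) 1"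
    have "y = (Q2 * C)\<^sup>T * y" using y(1) D e(3) by (simp add: mult_one_left_dim)
    also have "\<dots> = C\<^sup>T * (vcat (D1\<^sup>T * y) (D2\<^sup>T * y))"
      using y(1) D C unfolding D(1) by (simp add: transpose_mult_dim transpose_hcat mult_assoc_dim vcat_mult)
    also have "\<dots> = 0\<^sub>m ?z 1" using y D C by (simp add: mult_zero_right_dim)
    finally show "y = 0\<^sub>m (dim_col D1\<^sup>T) 1" using D by simp
  qed
  have 3: "\<exists>R \<in> carrier_mat p r. K = A * R \<and> L = B * R"
    if K: "K \<in> carrier_mat q r" "L \<in> carrier_mat q r" "D1 * K + D2 * L = 0\<^sub>m ?z r" for K L r
  proof -
    have "Q2 * vcat K L = 0\<^sub>m ?z r" using K D by (simp add: hcat_mult_vcat)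
    have "vcat K L = (vcat A B * Q1 + C * Q2) * vcat K L" using e(4) K by (simp add: mult_one_left_dim)
    also have "\<dots> = vcat A B * (Q1 * vcat K L) + C * (Q2 * vcat K L)"
      using K A B Q1 Q2 C by (simp add: mult_add_left_dim mult_assoc_dim)
    also have "\<dots> = vcat A B * (Q1 * vcat K L)"
      using \<open>Q2 * vcat K L = _\<close> K A B Q1 C by (simp add: mult_zero_right_dim add_zero_right_dim)
    also have "\<dots> = vcat (A * (Q1 * vcat K L)) (B * (Q1 * vcat K L))" using A B Q1 by (simp add: vcat_mult)
    finally have "K = A * (Q1 * vcat K L) \<and> L = B * (Q1 * vcat K L)"
      using A B Q1 K by (subst (asm) vcat_inject) auto
    moreover have "Q1 * vcat K L \<in> carrier_mat p r" using Q1 K by auto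
    ultimately show ?thesis by blast
  qed
  show ?thesis by (rule that[OF le D(2,3) 1 2 3])
qed

text \<open>The inverse reflection, obtained by transposition.\<close>

lemma kernel_pair:
  fixes D1 :: "'a :: field mat"
  assumes "D1 \<in> carrier_mat z q" "D2 \<in> carrier_mat z q" "jointly_injective D1\<^sup>T D2\<^sup>T"
  obtains A B where "z \<le> q + q" "A \<in> carrier_mat q (q + q - z)" "B \<in> carrier_mat q (q + q - z)"
    "D1 * A + D2 * B = 0\<^sub>m z (q + q - z)" "jointly_injective A B"
proof -
  obtain E1 E2 where E: "z \<le> q + q" "E1 \<in> carrier_mat (q + q - z) q" "E2 \<in> carrier_mat (q + q - z) q"
    "E1 * D1\<^sup>T + E2 * D2\<^sup>T = 0\<^sub>m (q + q - z) z" "jointly_injective E1\<^sup>T E2\<^sup>T"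
    using cokernel_pair[OF _ _ assms(3), of q z] assms(1,2) by (metis transpose_carrier_mat)
  have "D1 * E1\<^sup>T + D2 * E2\<^sup>T = (E1 * D1\<^sup>T + E2 * D2\<^sup>T)\<^sup>T"
    using assms E(2,3) by (subst transpose_add[of _ "q + q - z" z]) (auto simp: transpose_mult_dim)
  then have "D1 * E1\<^sup>T + D2 * E2\<^sup>T = 0\<^sub>m z (q + q - z)" using E(4) by simp
  then show ?thesis using that[of "E1\<^sup>T" "E2\<^sup>T"] E by auto
qed

text \<open>A base change on both sides splits the pair into a \<open>q1 \<times> p1\<close> and a \<open>q2 \<times> p2\<close> pair with
  \<open>p1 - q1\<close> odd; \<open>p1 + q1\<close> is used since natural subtraction truncates.\<close>

definition splits_oddly :: "'a :: field mat \<Rightarrow> 'a mat \<Rightarrow> bool" where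
  "splits_oddly A B \<longleftrightarrow> (\<exists>P P' Q Q' q1 q2 p1 p2 A1 A2 B1 B2.
    mutually_inverse (dim_row A) P P' \<and> mutually_inverse (dim_col A) Q Q' \<and>
    dim_row A = q1 + q2 \<and> dim_col A = p1 + p2 \<and> odd (p1 + q1) \<and>
    A1 \<in> carrier_mat q1 p1 \<and> B1 \<in> carrier_mat q1 p1 \<and> A2 \<in> carrier_mat q2 p2 \<and> B2 \<in> carrier_mat q2 p2 \<and>
    P * A * Q = A1 \<oplus>\<^sub>m A2 \<and> P * B * Q = B1 \<oplus>\<^sub>m B2)"

text \<open>A consequence of Kronecker's classification (the indecomposable pairs have \<open>\<bar>p - q\<bar> \<le> 1\<close>), proved without it.
  A common kernel vector splits off a \<open>0 \<times> 1\<close> pair. Otherwise reflection replaces \<open>(p, q)\<close> by \<open>(q, 2 q - p)\<close>, which is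
  smaller and has the same difference. A splitting of the reflected pair is carried back by taking kernels of its
  two summands: these have dimensions \<open>p1 = 2 q1 - z1\<close> and \<open>p2 = 2 q2 - z2\<close>, so \<open>p1 - q1 = q1 - z1\<close> stays odd,
  and by exactness their sum is the original pair up to a base change.\<close>

lemma pencil_splits_oddly_wide:
  fixes A :: "'a :: field mat"
  assumes "A \<in> carrier_mat q p" "B \<in> carrier_mat q p" "q < p"
  shows "splits_oddly A B"
  using assms
proof (induction p arbitrary: q A B rule: less_induct)
  case (less p)
  note A = less.prems(1) and B = less.prems(2)
  show ?case
  proof (cases "jointly_injective A B")
    case False
    then obtain v where v: "v \<in> carrier_mat p 1" "v \<noteq> 0\<^sub>m p 1" "A * v = 0\<^sub>m q 1" "B * v = 0\<^sub>m q 1"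
      using A B by (auto simp: jointly_injective_def)
    obtain p' where p: "p = Suc p'" using less.prems(3) by (cases p) auto
    obtain C Q' where C: "C \<in> carrier_mat p p'" and Q: "mutually_inverse p (hcat v C) Q'"
      using column_extends_to_basis[of v p'] v(1,2) unfolding p by blast
    have split: "X * hcat v C = 0\<^sub>m 0 1 \<oplus>\<^sub>m (X * C)" if "X \<in> carrier_mat q p" "X * v = 0\<^sub>m q 1" for X
    proof -
      have "X * hcat v C = hcat (0\<^sub>m q 1) (X * C)" using that C v(1) by (simp add: mult_hcat)
      also have "\<dots> = 0\<^sub>m 0 1 \<oplus>\<^sub>m (X * C)"
        using that(1) by (intro eq_matI) (auto simp: hcat_def direct_sum_mat_def simp del: index_mult_mat(1))
      finally show ?thesis .
    qed
    have "1\<^sub>m q * A * hcat v C = 0\<^sub>m 0 1 \<oplus>\<^sub>m (A * C) \<and> 1\<^sub>m q * B * hcat v C = 0\<^sub>m 0 1 \<oplus>\<^sub>m (B * C)"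
      using split[OF A v(3)] split[OF B v(4)] A B by (simp add: mult_one_left_dim)
    moreover have "dim_row A = 0 + q" "dim_col A = 1 + p'" "odd (1 + 0 :: nat)" "mutually_inverse (dim_row A) (1\<^sub>m q) (1\<^sub>m q)"
      "mutually_inverse (dim_col A) (hcat v C) Q'" "0\<^sub>m 0 1 \<in> carrier_mat 0 1" "A * C \<in> carrier_mat q p'" "B * C \<in> carrier_mat q p'"
      using A B C Q p mutually_inverse_one by auto
    ultimately show ?thesis unfolding splits_oddly_def by blast
  next
    case True
    define z where "z = q + q - p"
    obtain D1 D2 where le: "p \<le> q + q" and D: "D1 \<in> carrier_mat z q" "D2 \<in> carrier_mat z q" and dinj: "jointly_injective D1\<^sup>T D2\<^sup>T"
      and exact: "\<And>K L r. K \<in> carrier_mat q r \<Longrightarrow> L \<in> carrier_mat q r \<Longrightarrow> D1 * K + D2 * L = 0\<^sub>m z r \<Longrightarrow>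
        \<exists>R \<in> carrier_mat p r. K = A * R \<and> L = B * R"
      using cokernel_pair[OF A B True] unfolding z_def by metis
    have "z < q" using less.prems(3) le by (simp add: z_def)
    then have "splits_oddly D1 D2" using less.IH[of q D1 z D2] D less.prems(3) by simp
    then obtain P P' Q Q' z1 z2 q1 q2 E1 E2 F1 F2 where P: "mutually_inverse z P P'" and Q: "mutually_inverse q Q Q'"
      and zq': "dim_row D1 = z1 + z2" "dim_col D1 = q1 + q2" and zq3: "odd (q1 + z1)"
      and EF: "E1 \<in> carrier_mat z1 q1" "F1 \<in> carrier_mat z1 q1" "E2 \<in> carrier_mat z2 q2" "F2 \<in> carrier_mat z2 q2"
      and eq: "P * D1 * Q = E1 \<oplus>\<^sub>m E2" "P * D2 * Q = F1 \<oplus>\<^sub>m F2"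
      using D unfolding splits_oddly_def by (metis carrier_matD)
    have zq: "z = z1 + z2" "q = q1 + q2" using zq' D by auto
    note P' = mutually_inverseD[OF P] and Q' = mutually_inverseD[OF Q]
    have "jointly_injective (E1 \<oplus>\<^sub>m E2)\<^sup>T (F1 \<oplus>\<^sub>m F2)\<^sup>T"
      unfolding jointly_injective_def
    proof (intro ballI impI)
      fix x assume x: "x \<in> carrier_mat (dim_col (E1 \<oplus>\<^sub>m E2)\<^sup>T) 1"
        "(E1 \<oplus>\<^sub>m E2)\<^sup>T * x = 0\<^sub>m (dim_row (E1 \<oplus>\<^sub>m E2)\<^sup>T) 1" "(F1 \<oplus>\<^sub>m F2)\<^sup>T * x = 0\<^sub>m (dim_row (F1 \<oplus>\<^sub>m F2)\<^sup>T) 1"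
      have xz: "x \<in> carrier_mat z 1" using x(1) EF zq by simp
      have *: "X\<^sup>T * (P\<^sup>T * x) = 0\<^sub>m q 1" if X: "X \<in> carrier_mat z q" "(P * X * Q)\<^sup>T * x = 0\<^sub>m q 1" for X
      proof -
        have "Q\<^sup>T * (X\<^sup>T * (P\<^sup>T * x)) = 0\<^sub>m q 1" using X xz P' Q' by (simp add: block_simps)
        then have "Q'\<^sup>T * (Q\<^sup>T * (X\<^sup>T * (P\<^sup>T * x))) = Q'\<^sup>T * 0\<^sub>m q 1" by simp
        then show ?thesis
          using mutually_inverse_cancel(2)[OF mutually_inverse_transpose[OF Q], of "X\<^sup>T * (P\<^sup>T * x)"] X Q' by (simp add: block_simps)
      qed
      have "P\<^sup>T * x = 0\<^sub>m z 1"
        by (rule jointly_injectiveD[OF dinj, of q]) (use * D x eq EF zq xz P' in auto)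
      then have "P'\<^sup>T * (P\<^sup>T * x) = P'\<^sup>T * 0\<^sub>m z 1" by simp
      then have "x = 0\<^sub>m z 1"
        using mutually_inverse_cancel(2)[OF mutually_inverse_transpose[OF P], of x] xz P' by (simp add: block_simps)
      then show "x = 0\<^sub>m (dim_col (E1 \<oplus>\<^sub>m E2)\<^sup>T) 1" using EF zq by simp
    qed
    then have inj: "jointly_injective E1\<^sup>T F1\<^sup>T" "jointly_injective E2\<^sup>T F2\<^sup>T"
      using EF jointly_injective_direct_sum[of "E1\<^sup>T" q1 z1 "F1\<^sup>T" "E2\<^sup>T" q2 z2 "F2\<^sup>T"]
      by (auto simp: direct_sum_transpose)
    define p1 where "p1 = q1 + q1 - z1"
    define p2 where "p2 = q2 + q2 - z2"
    obtain A1 B1 where z1: "z1 \<le> q1 + q1" and AB1: "A1 \<in> carrier_mat q1 p1" "B1 \<in> carrier_mat q1 p1"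
      "E1 * A1 + F1 * B1 = 0\<^sub>m z1 p1" "jointly_injective A1 B1"
      using kernel_pair[OF EF(1,2) inj(1)] unfolding p1_def by metis
    obtain A2 B2 where z2: "z2 \<le> q2 + q2" and AB2: "A2 \<in> carrier_mat q2 p2" "B2 \<in> carrier_mat q2 p2"
      "E2 * A2 + F2 * B2 = 0\<^sub>m z2 p2" "jointly_injective A2 B2"
      using kernel_pair[OF EF(3,4) inj(2)] unfolding p2_def by metis
    have p: "p = p1 + p2" using z1 z2 zq le z_def by (simp add: p1_def p2_def)
    have "odd (p1 + q1)" using z1 zq3 by (simp add: p1_def)
    let ?A = "A1 \<oplus>\<^sub>m A2" and ?B = "B1 \<oplus>\<^sub>m B2"
    have "P * (D1 * (Q * ?A) + D2 * (Q * ?B)) = (P * D1 * Q) * ?A + (P * D2 * Q) * ?B"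
      using P' Q' D AB1 AB2 zq by (simp add: block_simps)
    also have "\<dots> = 0\<^sub>m z p"
      using AB1 AB2 EF zq p unfolding eq by (simp add: direct_sum_mult direct_sum_add)
    finally have "P' * (P * (D1 * (Q * ?A) + D2 * (Q * ?B))) = P' * 0\<^sub>m z p" by simp
    \<comment> \<open>both Q * ?A, Q * ?B and A, B parametrise the kernel of [D1 D2], hence differ by an invertible R\<close>
    then have "D1 * (Q * ?A) + D2 * (Q * ?B) = 0\<^sub>m z p"
      using mutually_inverse_cancel(2)[OF P, of "D1 * (Q * ?A) + D2 * (Q * ?B)"] P' D by (simp add: mult_zero_right_dim)
    moreover have "Q * ?A \<in> carrier_mat q p" "Q * ?B \<in> carrier_mat q p" using Q' AB1 AB2 p by auto
    ultimately obtain R where R: "R \<in> carrier_mat p p" "Q * ?A = A * R" "Q * ?B = B * R"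
      using exact by blast
    have QA: "Q' * A * R = ?A" "Q' * B * R = ?B"
      using mutually_inverse_cancel(2)[OF Q] R A B Q' AB1 AB2 zq by (simp_all add: mult_assoc_dim flip: R(2,3))
    have "jointly_injective (Q' * A * R) (Q' * B * R)"
      unfolding QA using AB1 AB2 jointly_injective_direct_sum[of A1 q1 p1 B1 A2 q2 p2 B2] by simp
    then obtain R' where R': "mutually_inverse p R R'"
      using jointly_injective_square[of "Q' * A" q p "Q' * B" R] injective_mat_invertible[OF R(1)] A B Q' R(1) by auto
    have "mutually_inverse (dim_row A) Q' Q" "mutually_inverse (dim_col A) R R'" "dim_row A = q1 + q2" "dim_col A = p1 + p2"
      using mutually_inverse_sym[OF Q] R' A zq p by auto
    then show ?thesis unfolding splits_oddly_def using QA AB1 AB2 \<open>odd (p1 + q1)\<close> by blast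
  qed
qed

lemma pencil_splits_oddly:
  fixes A :: "'a :: field mat"
  assumes A: "A \<in> carrier_mat q p" and B: "B \<in> carrier_mat q p" and "q \<noteq> p"
  shows "splits_oddly A B"
proof (cases "q < p")
  case True
  then show ?thesis using pencil_splits_oddly_wide[OF A B] by simp
next
  case False
  then have "splits_oddly A\<^sup>T B\<^sup>T" using pencil_splits_oddly_wide[of "A\<^sup>T" p q "B\<^sup>T"] assms by simp
  then obtain P P' Q Q' q1 q2 p1 p2 A1 A2 B1 B2 where P: "mutually_inverse p P P'" and Q: "mutually_inverse q Q Q'"
    and qp: "p = p1 + p2" "q = q1 + q2" "odd (q1 + p1)"
    and AB: "A1 \<in> carrier_mat p1 q1" "B1 \<in> carrier_mat p1 q1" "A2 \<in> carrier_mat p2 q2" "B2 \<in> carrier_mat p2 q2"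
    and e: "P * A\<^sup>T * Q = A1 \<oplus>\<^sub>m A2" "P * B\<^sup>T * Q = B1 \<oplus>\<^sub>m B2"
    unfolding splits_oddly_def index_transpose_mat carrier_matD[OF A] by blast
  have *: "(P * X\<^sup>T * Q)\<^sup>T = Q\<^sup>T * X * P\<^sup>T" if "X \<in> carrier_mat q p" for X
    using that mutually_inverseD[OF P] mutually_inverseD[OF Q] by (simp add: block_simps)
  have "Q\<^sup>T * A * P\<^sup>T = A1\<^sup>T \<oplus>\<^sub>m A2\<^sup>T" "Q\<^sup>T * B * P\<^sup>T = B1\<^sup>T \<oplus>\<^sub>m B2\<^sup>T"
    using *[OF A] *[OF B] e by (simp_all add: direct_sum_transpose)
  moreover have "mutually_inverse (dim_row A) Q\<^sup>T Q'\<^sup>T" "mutually_inverse (dim_col A) P\<^sup>T P'\<^sup>T"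
    using mutually_inverse_transpose[OF P] mutually_inverse_transpose[OF Q] A by auto
  moreover have "A1\<^sup>T \<in> carrier_mat q1 p1" "B1\<^sup>T \<in> carrier_mat q1 p1" "A2\<^sup>T \<in> carrier_mat q2 p2" "B2\<^sup>T \<in> carrier_mat q2 p2"
    "dim_row A = q1 + q2" "dim_col A = p1 + p2" using AB A qp by auto
  ultimately show ?thesis unfolding splits_oddly_def using qp(3) by (metis add.commute)
qed

section \<open>Fitting decomposition\<close>

lemma pow_mat_Suc_left:
  fixes A :: "'a :: semiring_1 mat"
  assumes "A \<in> carrier_mat n n" shows "A ^\<^sub>m Suc k = A * A ^\<^sub>m k"
proof (induction k)
  case (Suc k)
  have "A ^\<^sub>m Suc (Suc k) = A * A ^\<^sub>m k * A" using Suc by simp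
  then show ?case using assms by (simp add: mult_assoc_dim)
qed (use assms in \<open>simp add: mult_one_left_dim mult_one_right_dim\<close>)

lemma pow_upper_block:
  fixes A :: "'a :: comm_semiring_1 mat"
  assumes A: "A \<in> carrier_mat n n" and B: "B \<in> carrier_mat n m" and D: "D \<in> carrier_mat m m"
  shows "\<exists>X Y. X \<in> carrier_mat n n \<and> Y \<in> carrier_mat n m \<and>
    four_block_mat A B (0\<^sub>m m n) D ^\<^sub>m k = four_block_mat X Y (0\<^sub>m m n) (D ^\<^sub>m k)"
proof (induction k)
  case 0
  have "four_block_mat A B (0\<^sub>m m n) D ^\<^sub>m 0 = four_block_mat (1\<^sub>m n) (0\<^sub>m n m) (0\<^sub>m m n) (D ^\<^sub>m 0)" using A D by simp
  then show ?case by (intro exI[of _ "1\<^sub>m n"] exI[of _ "0\<^sub>m n m"]) simp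
next
  case (Suc k)
  then obtain X Y where XY: "X \<in> carrier_mat n n" "Y \<in> carrier_mat n m"
    and e: "four_block_mat A B (0\<^sub>m m n) D ^\<^sub>m k = four_block_mat X Y (0\<^sub>m m n) (D ^\<^sub>m k)" by blast
  have "four_block_mat A B (0\<^sub>m m n) D ^\<^sub>m Suc k = four_block_mat X Y (0\<^sub>m m n) (D ^\<^sub>m k) * four_block_mat A B (0\<^sub>m m n) D"
    using e by simp
  also have "\<dots> = four_block_mat (X * A) (X * B + Y * D) (0\<^sub>m m n) (D ^\<^sub>m Suc k)"
    using XY A B D by (simp add: block_simps)
  finally show ?case using XY A B D by (intro exI[of _ "X * A"] exI[of _ "X * B + Y * D"]) auto
qed

lemma nilpotent_prepend_zero_column:
  fixes T :: "'a :: field mat"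
  assumes T: "T \<in> carrier_mat m m" "T ^\<^sub>m N = 0\<^sub>m m m" and r: "r \<in> carrier_mat 1 m"
  shows "four_block_mat (0\<^sub>m 1 1) r (0\<^sub>m m 1) T ^\<^sub>m Suc N = 0\<^sub>m (Suc m) (Suc m)"
proof -
  let ?A = "four_block_mat (0\<^sub>m 1 1) r (0\<^sub>m m 1) T"
  obtain X Y where XY: "X \<in> carrier_mat 1 1" "Y \<in> carrier_mat 1 m" "?A ^\<^sub>m N = four_block_mat X Y (0\<^sub>m m 1) (0\<^sub>m m m)"
    using pow_upper_block[OF zero_carrier_mat r T(1), of N] T(2) by auto
  have "?A ^\<^sub>m Suc N = ?A * ?A ^\<^sub>m N" using r T by (intro pow_mat_Suc_left[of _ "1 + m"]) auto
  also have "\<dots> = four_block_mat (0\<^sub>m 1 1) (0\<^sub>m 1 m) (0\<^sub>m m 1) (0\<^sub>m m m)"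
    unfolding XY(3) using XY(1,2) r T by (simp add: block_simps del: four_block_zero_mat)
  finally show ?thesis by simp
qed

text \<open>Conjugation with a unit upper triangular block matrix with corner \<open>Y\<close> changes the corner \<open>B\<close> by \<open>A Y - Y D\<close>.
  As \<open>D\<close> has the inverse \<open>W\<close> and \<open>A B = 0\<close>, the choice \<open>Y = B W\<close> solves this Sylvester equation.\<close>

lemma block_upper_split_off_invertible:
  fixes A :: "'a :: field mat"
  assumes A: "A \<in> carrier_mat n n" and D: "mutually_inverse m D W" and B: "B \<in> carrier_mat n m" and AB: "A * B = 0\<^sub>m n m"
  obtains P Q where "mutually_inverse (n + m) P Q" "Q * four_block_mat A B (0\<^sub>m m n) D * P = A \<oplus>\<^sub>m D"
proof -
  note D' = mutually_inverseD[OF D]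
  let ?Y = "B * W"
  have Y: "?Y \<in> carrier_mat n m" "- ?Y \<in> carrier_mat n m" using B D' by auto
  have YD: "?Y * D = B" using B D' by (simp add: block_simps)
  have AY: "A * ?Y = 0\<^sub>m n m" 
  proof -
    have "A * ?Y = (A * B) * W" using A B D' by (simp add: mult_assoc_dim)
    then show ?thesis using AB D' by (simp add: mult_zero_left_dim)
  qed
  let ?P = "four_block_mat (1\<^sub>m n) ?Y (0\<^sub>m m n) (1\<^sub>m m)" and ?Q = "four_block_mat (1\<^sub>m n) (- ?Y) (0\<^sub>m m n) (1\<^sub>m m)"
  have "B + - ?Y * D = 0\<^sub>m n m"
  proof -
    have "- ?Y * D = - (?Y * D)" using Y D' by (subst uminus_mult_left_mat) auto
    then show ?thesis using B YD by (intro eq_matI) auto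
  qed
  then have "?Q * four_block_mat A B (0\<^sub>m m n) D = A \<oplus>\<^sub>m D"
    using A B D' Y by (simp add: block_simps direct_sum_mat_def)
  moreover have "(A \<oplus>\<^sub>m D) * ?P = A \<oplus>\<^sub>m D"
    using A B D' AY unfolding direct_sum_mat_def
    by (simp add: block_mult_dim mult_one_right_dim mult_zero_left_dim mult_zero_right_dim add_zero_left_dim add_zero_right_dim)
  ultimately have "?Q * four_block_mat A B (0\<^sub>m m n) D * ?P = A \<oplus>\<^sub>m D" by simp
  then show ?thesis using that mutually_inverse_unit_upper[OF Y(1)] by blast
qed

text \<open>Every matrix is similar to a direct sum of a nilpotent and an invertible one. In the inductive step a kernel vector becomes
  the first basis vector; the induction hypothesis decomposes the remaining lower right block, and the invertible
  part is then separated from the first row. No factorization of the characteristic polynomial is involved,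
  so this works over every field.\<close>

lemma fitting_decomposition:
  fixes T :: "'a :: field mat"
  assumes "T \<in> carrier_mat n n"
  shows "\<exists>P Q n1 n2 T1 T2 N W. mutually_inverse n P Q \<and> n = n1 + n2 \<and> T1 \<in> carrier_mat n1 n1 \<and>
    mutually_inverse n2 T2 W \<and> Q * T * P = T1 \<oplus>\<^sub>m T2 \<and> T1 ^\<^sub>m N = 0\<^sub>m n1 n1"
  using assms
proof (induction n arbitrary: T rule: less_induct)
  case (less n)
  note T = less.prems
  show ?case
  proof (cases "injective_mat T")
    case True
    then obtain W where W: "mutually_inverse n T W" using injective_mat_invertible[OF T] by blast
    have "1\<^sub>m n * T * 1\<^sub>m n = 0\<^sub>m 0 0 \<oplus>\<^sub>m T"
      using T by (simp add: block_simps) (rule eq_matI; simp add: direct_sum_mat_def)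
    moreover have "0\<^sub>m 0 0 ^\<^sub>m 0 = (0\<^sub>m 0 0 :: 'a mat)" by auto
    moreover have "n = 0 + n" "0\<^sub>m 0 0 \<in> carrier_mat 0 0" by auto
    ultimately show ?thesis using W mutually_inverse_one[of n]
      by (intro exI[of _ "1\<^sub>m n"] exI[of _ "0 :: nat"] exI[of _ n]
        exI[of _ "0\<^sub>m 0 0"] exI[of _ T] exI[of _ W] conjI)
  next
    case False
    then obtain v where v: "v \<in> carrier_mat n 1" "v \<noteq> 0\<^sub>m n 1" "T * v = 0\<^sub>m n 1"
      using injective_mat_iff[OF T] by blast
    obtain m where n: "n = Suc m" using v by (cases n) (auto intro!: eq_matI)
    obtain C Q where C: "C \<in> carrier_mat n m" and Q: "mutually_inverse n (hcat v C) Q"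
      using column_extends_to_basis[of v m] v(1,2) unfolding n by blast
    note Q' = mutually_inverseD[OF Q]
    have "Q * (T * C) \<in> carrier_mat (1 + m) m" using Q' T C n by auto
    from vcat_split[OF this] obtain r T' where rT: "Q * (T * C) = vcat r T'" and r: "r \<in> carrier_mat 1 m" and T': "T' \<in> carrier_mat m m" .
    have QT: "Q * T * hcat v C = four_block_mat (0\<^sub>m 1 1) r (0\<^sub>m m 1) T'"
    proof -
      have "Q * T * hcat v C = hcat (Q * (T * v)) (Q * (T * C))" using Q' T v(1) C by (simp add: mult_assoc_dim mult_hcat)
      also have "\<dots> = hcat (vcat (0\<^sub>m 1 1) (0\<^sub>m m 1)) (vcat r T')" using v(3) rT Q' n by (simp add: mult_zero_right_dim)
      also have "\<dots> = four_block_mat (0\<^sub>m 1 1) r (0\<^sub>m m 1) T'"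
        using r T' by (intro eq_matI) (auto simp: hcat_def vcat_def)
      finally show ?thesis .
    qed
    from less.IH[of m T'] T' n obtain P1 Q1 m1 m2 T1 T2 N W where P1: "mutually_inverse m P1 Q1" and m: "m = m1 + m2"
      and T1: "T1 \<in> carrier_mat m1 m1" and T2: "mutually_inverse m2 T2 W" and e: "Q1 * T' * P1 = T1 \<oplus>\<^sub>m T2" and nil: "T1 ^\<^sub>m N = 0\<^sub>m m1 m1"
      by blast
    note P1' = mutually_inverseD[OF P1] and T2' = mutually_inverseD[OF T2]
    have "r * P1 \<in> carrier_mat 1 (m1 + m2)" using r P1' m by auto
    from hcat_split[OF this] obtain r1 r2 where rr: "r * P1 = hcat r1 r2" "r1 \<in> carrier_mat 1 m1" "r2 \<in> carrier_mat 1 m2" .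
    let ?A = "four_block_mat (0\<^sub>m 1 1) r1 (0\<^sub>m m1 1) T1" and ?B = "vcat r2 (0\<^sub>m m1 m2)"
    let ?I = "1\<^sub>m 1 :: 'a mat"
    have P2: "mutually_inverse n (?I \<oplus>\<^sub>m P1) (?I \<oplus>\<^sub>m Q1)"
      using mutually_inverse_direct_sum[OF mutually_inverse_one P1, of 1] n by simp
    have "(?I \<oplus>\<^sub>m Q1) * four_block_mat (0\<^sub>m 1 1) r (0\<^sub>m m 1) T' * (?I \<oplus>\<^sub>m P1) =
        four_block_mat (0\<^sub>m 1 1) (r * P1) (0\<^sub>m m 1) (Q1 * T' * P1)"
      using P1' r T' by (simp add: direct_sum_mat_def block_simps)
    also have "\<dots> = four_block_mat ?A ?B (0\<^sub>m m2 (1 + m1)) T2"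
      unfolding e rr(1) using rr T1 T2' m
      by (intro eq_matI) (auto simp: hcat_def vcat_def direct_sum_mat_def)
    finally have 1: "(?I \<oplus>\<^sub>m Q1) * (Q * T * hcat v C) * (?I \<oplus>\<^sub>m P1) = four_block_mat ?A ?B (0\<^sub>m m2 (1 + m1)) T2"
      unfolding QT .
    \<comment> \<open>only the first row of the corner is nonzero, and the first column of ?A vanishes\<close>
    have "?A * ?B = 0\<^sub>m (1 + m1) m2"
      using rr T1 by (simp add: vcat_def block_simps)
    moreover have "?A \<in> carrier_mat (1 + m1) (1 + m1)" "?B \<in> carrier_mat (1 + m1) m2" using T1 rr by auto
    moreover have "n = 1 + m1 + m2" using n m by simp
    ultimately obtain P3 Q3 where P3: "mutually_inverse n P3 Q3" and 2: "Q3 * four_block_mat ?A ?B (0\<^sub>m m2 (1 + m1)) T2 * P3 = ?A \<oplus>\<^sub>m T2"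
      using block_upper_split_off_invertible[of ?A "1 + m1" m2 T2 W ?B] T2 by metis
    have "mutually_inverse n (hcat v C * (?I \<oplus>\<^sub>m P1) * P3) (Q3 * ((?I \<oplus>\<^sub>m Q1) * Q))"
      by (intro mutually_inverse_mult Q P2 P3)
    moreover have "(Q3 * ((?I \<oplus>\<^sub>m Q1) * Q)) * T * (hcat v C * (?I \<oplus>\<^sub>m P1) * P3) = ?A \<oplus>\<^sub>m T2"
      unfolding 2[symmetric] 1[symmetric]
      using Q' mutually_inverseD[OF P2] mutually_inverseD[OF P3] T by (simp add: mult_assoc_dim)
    moreover have "n = (1 + m1) + m2" using n m by simp
    moreover have "?A \<in> carrier_mat (1 + m1) (1 + m1)" using T1 rr by auto
    moreover have "?A ^\<^sub>m Suc N = 0\<^sub>m (1 + m1) (1 + m1)"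
      using nilpotent_prepend_zero_column[OF T1 nil rr(2)] by simp
    ultimately show ?thesis using T2
      by (intro exI[of _ "hcat v C * (?I \<oplus>\<^sub>m P1) * P3"] exI[of _ "Q3 * ((?I \<oplus>\<^sub>m Q1) * Q)"] exI[of _ "1 + m1"] exI[of _ m2]
        exI[of _ ?A] exI[of _ T2] exI[of _ "Suc N"] exI[of _ W] conjI)
  qed
qed

section \<open>Polynomials of a matrix\<close>

definition poly_mat :: "'a :: comm_ring_1 poly \<Rightarrow> 'a mat \<Rightarrow> 'a mat" where
  "poly_mat f S = fold_coeffs (\<lambda>a B. a \<cdot>\<^sub>m 1\<^sub>m (dim_row S) + S * B) f (0\<^sub>m (dim_row S) (dim_row S))"

lemma poly_mat_0: "S \<in> carrier_mat n n \<Longrightarrow> poly_mat 0 S = 0\<^sub>m n n"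
  by (simp add: poly_mat_def)

lemma poly_mat_pCons:
  assumes "S \<in> carrier_mat n n"
  shows "poly_mat (pCons a f) S = a \<cdot>\<^sub>m 1\<^sub>m n + S * poly_mat f S"
proof (cases "f = 0 \<and> a = 0")
  case True
  have "0 \<cdot>\<^sub>m 1\<^sub>m n + S * 0\<^sub>m n n = 0\<^sub>m n n" using assms by (intro eq_matI) auto
  then show ?thesis using True assms by (simp add: poly_mat_def)
qed (use assms in \<open>auto simp: poly_mat_def\<close>)

lemma poly_mat_carrier: "S \<in> carrier_mat n n \<Longrightarrow> poly_mat f S \<in> carrier_mat n n"
  by (induction f) (auto simp: poly_mat_0 poly_mat_pCons)

lemma poly_mat_dim [simp]:
  assumes "S \<in> carrier_mat n n"
  shows "dim_row (poly_mat f S) = n" "dim_col (poly_mat f S) = n"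
  using poly_mat_carrier[OF assms, of f] by auto

lemma poly_mat_add:
  assumes S: "S \<in> carrier_mat n n"
  shows "poly_mat (f + g) S = poly_mat f S + poly_mat g S"
proof (induction f g rule: poly_induct2)
  case (pCons a f b g)
  have "poly_mat (pCons a f + pCons b g) S = (a + b) \<cdot>\<^sub>m 1\<^sub>m n + S * (poly_mat f S + poly_mat g S)"
    using pCons S by (simp add: poly_mat_pCons)
  also have "S * (poly_mat f S + poly_mat g S) = S * poly_mat f S + S * poly_mat g S"
    using S by (simp add: mult_add_right_dim)
  also have "(a + b) \<cdot>\<^sub>m 1\<^sub>m n + \<dots> = (a \<cdot>\<^sub>m 1\<^sub>m n + S * poly_mat f S) + (b \<cdot>\<^sub>m 1\<^sub>m n + S * poly_mat g S)"
    using S by (intro eq_matI) (auto simp: algebra_simps simp del: index_mult_mat(1))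
  finally show ?case using S by (simp add: poly_mat_pCons)
qed (use assms in \<open>simp add: poly_mat_0\<close>)

lemma poly_mat_smult:
  assumes S: "S \<in> carrier_mat n n"
  shows "poly_mat (smult c f) S = c \<cdot>\<^sub>m poly_mat f S"
proof (induction f)
  case (pCons a f)
  then have "poly_mat (smult c (pCons a f)) S = (c * a) \<cdot>\<^sub>m 1\<^sub>m n + c \<cdot>\<^sub>m (S * poly_mat f S)"
    using S by (simp add: poly_mat_pCons smult_right_dim)
  also have "\<dots> = c \<cdot>\<^sub>m (a \<cdot>\<^sub>m 1\<^sub>m n + S * poly_mat f S)"
    using S by (intro eq_matI) (auto simp: algebra_simps simp del: index_mult_mat(1))
  finally show ?case using S by (simp add: poly_mat_pCons)
qed (use assms in \<open>auto simp: poly_mat_0\<close>)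

lemma poly_mat_mult:
  assumes S: "S \<in> carrier_mat n n"
  shows "poly_mat (f * g) S = poly_mat f S * poly_mat g S"
proof (induction f)
  case 0
  show ?case using S by (simp add: poly_mat_0 mult_zero_left_dim)
next
  case (pCons a f)
  have "poly_mat (pCons a f * g) S = a \<cdot>\<^sub>m poly_mat g S + (0 \<cdot>\<^sub>m 1\<^sub>m n + S * (poly_mat f S * poly_mat g S))"
    using pCons S by (simp add: poly_mat_add poly_mat_smult poly_mat_pCons)
  also have "0 \<cdot>\<^sub>m 1\<^sub>m n + S * (poly_mat f S * poly_mat g S) = S * (poly_mat f S * poly_mat g S)"
    using S by (intro eq_matI) (auto simp del: index_mult_mat(1))
  finally show ?case using S by (simp add: poly_mat_pCons mult_add_left_dim smult_left_dim mult_one_left_dim mult_assoc_dim)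
qed

lemma poly_mat_monom:
  assumes S: "S \<in> carrier_mat n n"
  shows "poly_mat (monom c k) S = c \<cdot>\<^sub>m S ^\<^sub>m k"
proof (induction k)
  case 0
  show ?case using S by (simp add: monom_0 poly_mat_pCons poly_mat_0 mult_zero_right_dim add_zero_right_dim)
next
  case (Suc k)
  have "poly_mat (monom c (Suc k)) S = 0 \<cdot>\<^sub>m 1\<^sub>m n + c \<cdot>\<^sub>m S ^\<^sub>m Suc k"
    unfolding pow_mat_Suc_left[OF S] using Suc S by (simp add: monom_Suc poly_mat_pCons smult_right_dim)
  then show ?case using S by (auto intro!: eq_matI)
qed

lemma poly_mat_power:
  assumes S: "S \<in> carrier_mat n n"
  shows "poly_mat (f ^ k) S = poly_mat f S ^\<^sub>m k"
proof (induction k)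
  case 0
  show ?case using S poly_mat_monom[OF S, of 1 0] by (auto intro!: eq_matI)
next
  case (Suc k)
  then show ?case using S poly_mat_mult[OF S, of "f ^ k" f] by (simp add: mult.commute)
qed

text \<open>This one rule specializes to commuting matrices, to similar matrices and, with \<open>S\<close> replaced by a transpose,
  to the adjoint relation of an isometry.\<close>

lemma poly_mat_intertwine:
  assumes S: "S \<in> carrier_mat n n" and S': "S' \<in> carrier_mat m m" and A: "A \<in> carrier_mat n m" and e: "S * A = A * S'"
  shows "poly_mat f S * A = A * poly_mat f S'"
proof (induction f)
  case 0
  show ?case using S S' A by (simp add: poly_mat_0 mult_zero_left_dim mult_zero_right_dim)
next
  case (pCons a f)
  have "S * poly_mat f S * A = S * (A * poly_mat f S')"
    using pCons S S' A by (simp add: mult_assoc_dim)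
  also have "\<dots> = A * (S' * poly_mat f S')"
    using e S S' A by (simp flip: mult_assoc_dim)
  finally show ?case
    using S S' A by (simp add: poly_mat_pCons mult_add_left_dim mult_add_right_dim smult_left_dim smult_right_dim mult_one_left_dim mult_one_right_dim)
qed

lemma poly_mat_direct_sum:
  assumes "S1 \<in> carrier_mat n n" "S2 \<in> carrier_mat m m"
  shows "poly_mat f (S1 \<oplus>\<^sub>m S2) = poly_mat f S1 \<oplus>\<^sub>m (poly_mat f S2 :: 'a :: field mat)"
proof (induction f)
  case 0
  have "S1 \<oplus>\<^sub>m S2 \<in> carrier_mat (n + m) (n + m)" using assms by auto
  then show ?case using assms by (simp add: poly_mat_0)
next
  case (pCons a f)
  have S: "S1 \<oplus>\<^sub>m S2 \<in> carrier_mat (n + m) (n + m)" using assms by auto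
  have "a \<cdot>\<^sub>m 1\<^sub>m (n + m) = a \<cdot>\<^sub>m 1\<^sub>m n \<oplus>\<^sub>m a \<cdot>\<^sub>m 1\<^sub>m m"
    by (rule eq_matI) (auto simp: direct_sum_mat_def)
  then show ?case using assms pCons by (simp add: poly_mat_pCons[OF S] poly_mat_pCons direct_sum_mult direct_sum_add)
qed

lemma poly_mat_transpose:
  assumes S: "S \<in> carrier_mat n n"
  shows "poly_mat f S\<^sup>T = (poly_mat f S)\<^sup>T"
proof (induction f)
  case 0
  show ?case using S by (simp add: poly_mat_0)
next
  case (pCons a f)
  have comm: "S * poly_mat f S = poly_mat f S * S" using poly_mat_intertwine[OF S S S] by simp
  have "(a \<cdot>\<^sub>m 1\<^sub>m n + S * poly_mat f S)\<^sup>T = a \<cdot>\<^sub>m 1\<^sub>m n + (poly_mat f S * S)\<^sup>T"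
    unfolding comm using S by (intro eq_matI) (auto simp del: index_mult_mat(1))
  then show ?case using S pCons by (simp add: poly_mat_pCons[of _ n] transpose_mult_dim)
qed

text \<open>\<open>x\<^sup>d f(1/x)\<close> is the reflected polynomial of \<open>f\<close>, here with the inverse matrix in place of \<open>1/x\<close>.\<close>

lemma poly_mat_reflect:
  assumes SR: "mutually_inverse n S R"
  shows "S ^\<^sub>m degree f * poly_mat f R = poly_mat (reflect_poly f) S"
proof (induction f)
  case 0
  show ?case using mutually_inverseD[OF SR] by (simp add: poly_mat_0 mult_zero_right_dim)
next
  case (pCons a f)
  note SR' = mutually_inverseD[OF SR]
  show ?case
  proof (cases "f = 0")
    case True
    then show ?thesis using SR' by (simp add: poly_mat_pCons[of _ n] poly_mat_0[of _ n] mult_one_left_dim mult_zero_right_dim)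
  next
    case False
    let ?d = "degree f"
    have "S ^\<^sub>m Suc ?d * R = S ^\<^sub>m ?d" using SR' by (simp add: mult_assoc_dim mult_one_right_dim)
    then have "S ^\<^sub>m Suc ?d * (R * poly_mat f R) = S ^\<^sub>m ?d * poly_mat f R"
      using SR' poly_mat_dim[OF SR'(2), of f] by (simp flip: mult_assoc_dim del: pow_mat.simps)
    then have "S ^\<^sub>m Suc ?d * poly_mat (pCons a f) R = a \<cdot>\<^sub>m S ^\<^sub>m Suc ?d + poly_mat (reflect_poly f) S"
      using SR' pCons(2) by (simp add: poly_mat_pCons[of _ n] mult_add_right_dim smult_right_dim mult_one_right_dim del: pow_mat.simps)
    also have "\<dots> = poly_mat (reflect_poly f) S + a \<cdot>\<^sub>m S ^\<^sub>m Suc ?d"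
      by (rule comm_add_mat[of _ n n]) (use SR'(1) in \<open>simp_all add: poly_mat_carrier pow_carrier_mat del: pow_mat.simps\<close>)
    also have "\<dots> = poly_mat (reflect_poly (pCons a f)) S"
      by (simp only: reflect_poly_pCons'[OF False] poly_mat_add[OF SR'(1)] poly_mat_monom[OF SR'(1)])
    finally show ?thesis using False by simp
  qed
qed

section \<open>Matrices annihilated by a power of a prime polynomial\<close>

text \<open>The factor theorem: \<open>x - S\<close> divides \<open>f(x) - f(S)\<close> in the matrices over polynomials. It is stated additively,
  with matrices over the field embedded as constant polynomials.\<close>

lemma char_poly_matrix_divides:
  fixes S :: "'a :: field mat"
  assumes S: "S \<in> carrier_mat n n"
  shows "\<exists>Q \<in> carrier_mat n n. f \<cdot>\<^sub>m 1\<^sub>m n = char_poly_matrix S * Q + map_mat (\<lambda>a. [:a:]) (poly_mat f S)"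
proof (induction f)
  case 0
  have "0 \<cdot>\<^sub>m 1\<^sub>m n = char_poly_matrix S * 0\<^sub>m n n + map_mat (\<lambda>a. [:a:]) (poly_mat 0 S)"
    using S by (intro eq_matI) (auto simp: poly_mat_0 char_poly_matrix_def)
  then show ?case by (rule bexI) simp
next
  case (pCons a f)
  let ?c = "\<lambda>a :: 'a. [:a:]" and ?X = "[:0, 1:] :: 'a poly" and ?K = "char_poly_matrix S"
  let ?F = "map_mat ?c (poly_mat f S)"
  from pCons obtain Q where Q: "Q \<in> carrier_mat n n" and f: "f \<cdot>\<^sub>m 1\<^sub>m n = ?K * Q + ?F" by blast
  have K: "?K \<in> carrier_mat n n" "dim_row ?K = n" "dim_col ?K = n"
    using carrier_matD[OF char_poly_matrix_closed[OF S]] S by auto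
  have F: "?F \<in> carrier_mat n n" using S by (simp add: poly_mat_carrier)
  interpret const: comm_ring_hom ?c by unfold_locales (auto simp: one_pCons)
  have hS: "map_mat ?c (S * poly_mat f S) = map_mat ?c S * ?F"
    by (rule const.mat_hom_mult[OF S poly_mat_carrier[OF S]])
  have XI: "?X \<cdot>\<^sub>m 1\<^sub>m n = ?K + map_mat ?c S"
    using S by (intro eq_matI) (auto simp: char_poly_matrix_def)
  have "?X \<cdot>\<^sub>m ?F = (?X \<cdot>\<^sub>m 1\<^sub>m n) * ?F" using F by (simp add: smult_left_dim mult_one_left_dim)
  also have "\<dots> = ?K * ?F + map_mat ?c S * ?F" unfolding XI using S K F by (simp add: mult_add_left_dim)
  finally have XF: "?X \<cdot>\<^sub>m ?F = ?K * ?F + map_mat ?c S * ?F" .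
  have "pCons a f \<cdot>\<^sub>m 1\<^sub>m n = ?c a \<cdot>\<^sub>m 1\<^sub>m n + ?X \<cdot>\<^sub>m (f \<cdot>\<^sub>m 1\<^sub>m n)"
    by (intro eq_matI) (auto simp: algebra_simps)
  also have "?X \<cdot>\<^sub>m (f \<cdot>\<^sub>m 1\<^sub>m n) = ?K * (?X \<cdot>\<^sub>m Q) + ?X \<cdot>\<^sub>m ?F"
    unfolding f using K Q F by (subst add_smult_distrib_left_mat[of _ n n]) (auto simp: smult_right_dim)
  also have "?c a \<cdot>\<^sub>m 1\<^sub>m n + \<dots> = ?K * (?X \<cdot>\<^sub>m Q + ?F) + (?c a \<cdot>\<^sub>m 1\<^sub>m n + map_mat ?c S * ?F)"
    unfolding XF using K Q F S by (simp add: mult_add_right_dim) (intro eq_matI; simp del: index_mult_mat(1))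
  also have "?c a \<cdot>\<^sub>m 1\<^sub>m n + map_mat ?c S * ?F = map_mat ?c (poly_mat (pCons a f) S)"
    using S unfolding poly_mat_pCons[OF S] hS[symmetric]
    by (intro eq_matI) (auto simp del: index_mult_mat(1))
  finally show ?case using Q F by (intro bexI[of _ "?X \<cdot>\<^sub>m Q + ?F"]) auto
qed

text \<open>Take determinants in the factor theorem \<open>f(x) = (x - S) Q\<close>.\<close>

lemma char_poly_dvd_annihilator_power:
  fixes S :: "'a :: field mat"
  assumes S: "S \<in> carrier_mat n n" and "poly_mat f S = 0\<^sub>m n n"
  shows "char_poly S dvd f ^ n"
proof -
  obtain Q where Q: "Q \<in> carrier_mat n n" and e: "f \<cdot>\<^sub>m 1\<^sub>m n = char_poly_matrix S * Q + map_mat (\<lambda>a. [:a:]) (0\<^sub>m n n)"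
    using char_poly_matrix_divides[OF S, of f] unfolding assms(2) by blast
  have "map_mat (\<lambda>a :: 'a. [:a:]) (0\<^sub>m n n) = 0\<^sub>m n n" by (intro eq_matI) auto
  then have "f \<cdot>\<^sub>m 1\<^sub>m n = char_poly_matrix S * Q" 
    using e Q carrier_matD[OF char_poly_matrix_closed[OF S]] by (simp add: add_zero_right_dim)
  then have "det (f \<cdot>\<^sub>m 1\<^sub>m n) = det (char_poly_matrix S) * det Q"
    using S Q det_mult[of "char_poly_matrix S" n Q] by simp
  then show ?thesis by (simp add: char_poly_def det_smult)
qed

lemma monic_dvd_prime_power:
  fixes p :: "'a :: field poly"
  assumes p: "prime_elem p" "lead_coeff p = 1"
  shows "a dvd p ^ k \<Longrightarrow> lead_coeff a = 1 \<Longrightarrow> \<exists>m. a = p ^ m"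
proof (induction k arbitrary: a)
  case 0
  then have "degree a = 0" using is_unit_iff_degree[of a] by auto
  then have "a = 1" using 0(2) by (auto elim!: degree_eq_zeroE simp: one_pCons)
  then show ?case by (intro exI[of _ 0]) simp
next
  case (Suc k)
  from Suc.prems(1) obtain b where b: "p ^ Suc k = a * b" by (rule dvdE)
  have "p dvd p ^ Suc k" by simp
  then have "p dvd a * b" unfolding b .
  then consider "p dvd a" | "p dvd b" using p(1) prime_elem_dvd_mult_iff by blast
  then show ?case
  proof cases
    case 1
    then obtain c where c: "a = p * c" by (rule dvdE)
    have "p * p ^ k = p * (c * b)" using b c by (simp add: mult.assoc)
    then have "p ^ k = c * b" using p(1) by auto
    moreover have "lead_coeff c = 1" using c p(2) Suc.prems(2) by (simp add: lead_coeff_mult)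
    ultimately obtain m where "c = p ^ m" using Suc.IH[of c] by auto
    then show ?thesis using c by (intro exI[of _ "Suc m"]) simp
  next
    case 2
    then obtain c where c: "b = p * c" by (rule dvdE)
    have "p * p ^ k = p * (a * c)" using b c by (simp add: mult_ac)
    then have "p ^ k = a * c" using p(1) by auto
    then show ?thesis using Suc.IH[of a] Suc.prems(2) by auto
  qed
qed

text \<open>The characteristic polynomial divides a power of \<open>p\<close>, hence is a power of \<open>p\<close>; its constant coefficient is the determinant
  up to the sign \<open>(-1)\<^sup>n\<close>. The determinant thus depends only on \<open>p\<close> and on the size, which is how the determinants on
  two dual subspaces are compared later.\<close>

lemma det_of_primary_mat:
  fixes S :: "'a :: field mat"
  assumes S: "S \<in> carrier_mat n n" and p: "prime_elem p" "lead_coeff p = 1" and nil: "poly_mat p S ^\<^sub>m N = 0\<^sub>m n n"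
  obtains m where "n = degree p * m" "det S = ((-1) ^ degree p * coeff p 0) ^ m"
proof -
  have "poly_mat (p ^ N) S = 0\<^sub>m n n" using nil S by (simp add: poly_mat_power)
  then have "char_poly S dvd p ^ (N * n)" using char_poly_dvd_annihilator_power[OF S] by (simp add: power_mult)
  moreover have cp: "degree (char_poly S) = n" "lead_coeff (char_poly S) = 1" using degree_monic_char_poly[OF S] by auto
  ultimately obtain m where m: "char_poly S = p ^ m" using monic_dvd_prime_power[OF p] by blast
  have "p \<noteq> 0" using p by auto
  then have n: "n = degree p * m" using cp(1) unfolding m by (simp add: degree_power_eq mult.commute)
  have "char_matrix S 0 = S" using S by (intro eq_matI) (auto simp: char_matrix_def)
  then have "poly (char_poly S) 0 = det (- S)" using char_poly_matrix[OF S, of 0] by simp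
  also have "- S = (-1) \<cdot>\<^sub>m S" by (intro eq_matI) auto
  finally have "coeff p 0 ^ m = (-1) ^ n * det S" using S unfolding m by (simp add: poly_0_coeff_0 coeff_0_power det_smult)
  then have "(-1) ^ n * coeff p 0 ^ m = (-1) ^ n * (-1) ^ n * det S" by simp
  also have "(-1) ^ n * (-1) ^ n = (1 :: 'a)" by (simp flip: power_mult_distrib)
  finally have "det S = ((-1) ^ degree p * coeff p 0) ^ m" by (simp add: n power_mult_distrib power_mult)
  with n that show ?thesis by blast
qed

text \<open>The \<open>n + 1\<close> vectors \<open>v, S v, \<dots>, S\<^sup>n v\<close> are linearly dependent.\<close>

lemma annihilating_poly_exists:
  fixes S :: "'a :: field mat"
  assumes S: "S \<in> carrier_mat n n" and v: "v \<in> carrier_mat n 1"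
  obtains f where "f \<noteq> 0" "poly_mat f S * v = 0\<^sub>m n 1"
proof -
  define K where "K = mat n (Suc n) (\<lambda>(i, j). (S ^\<^sub>m j * v) $$ (i, 0))"
  have K: "K \<in> carrier_mat n (Suc n)" by (simp add: K_def)
  obtain c where c: "c \<in> carrier_mat (Suc n) 1" "c \<noteq> 0\<^sub>m (Suc n) 1" "K * c = 0\<^sub>m n 1"
    using wide_mat_kernel[OF K] by auto
  define g where "g m = (\<Sum>j<m. monom (c $$ (j, 0)) j)" for m
  have g: "(poly_mat (g m) S * v) $$ (i, 0) = (\<Sum>j<m. c $$ (j, 0) * (S ^\<^sub>m j * v) $$ (i, 0))" if "i < n" for i m
  proof (induction m)
    case 0
    show ?case using S v that by (simp add: g_def poly_mat_0 mult_zero_left_dim)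
  next
    case (Suc m)
    have "poly_mat (g (Suc m)) S * v = poly_mat (g m) S * v + c $$ (m, 0) \<cdot>\<^sub>m (S ^\<^sub>m m * v)"
      using S v by (simp add: g_def poly_mat_add poly_mat_monom mult_add_left_dim smult_left_dim)
    then show ?case using Suc S v that by (simp del: index_mult_mat(1))
  qed
  have "poly_mat (g (Suc n)) S * v = 0\<^sub>m n 1"
  proof (rule eq_matI)
    fix i j assume ij: "i < dim_row (0\<^sub>m n 1 :: 'a mat)" "j < dim_col (0\<^sub>m n 1 :: 'a mat)"
    have "(K * c) $$ (i, 0) = (\<Sum>j<Suc n. c $$ (j, 0) * (S ^\<^sub>m j * v) $$ (i, 0))"
      using ij c(1) K by (auto simp: K_def scalar_prod_def mult.commute lessThan_atLeast0 simp del: index_mult_mat(1) intro!: sum.cong)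
        (auto simp: scalar_prod_def lessThan_atLeast0 mult.commute)
    then show "(poly_mat (g (Suc n)) S * v) $$ (i, j) = 0\<^sub>m n 1 $$ (i, j)" using g[of i "Suc n"] ij c(3) by simp
  qed (use S v in auto)
  moreover have "g (Suc n) \<noteq> 0"
  proof
    assume g0: "g (Suc n) = 0"
    have "c $$ (j, 0) = 0" if "j < Suc n" for j
    proof -
      have "coeff (g (Suc n)) j = (\<Sum>k<Suc n. if k = j then c $$ (k, 0) else 0)"
        by (simp add: g_def coeff_sum del: sum.lessThan_Suc)
      also have "\<dots> = c $$ (j, 0)" using that by (subst sum.delta) auto
      finally show ?thesis using g0 by simp
    qed
    then have "c = 0\<^sub>m (Suc n) 1" using c(1) by (intro eq_matI) auto
    then show False using c(2) by simp
  qed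
  ultimately show ?thesis using that by blast
qed

section \<open>Congruence and orthogonal summands of odd dimension\<close>

definition odd_summand :: "'a :: field mat \<Rightarrow> bool" where
  "odd_summand M \<longleftrightarrow> (\<exists>k m A B. odd k \<and> A \<in> carrier_mat k k \<and> B \<in> carrier_mat m m \<and> congruent_mat M (A \<oplus>\<^sub>m B))"

lemma congruent_mat_iff:
  assumes M: "M \<in> carrier_mat n n"
  shows "congruent_mat M N \<longleftrightarrow> (\<exists>P Q. mutually_inverse n P Q \<and> P\<^sup>T * M * P = N)"
proof
  assume "congruent_mat M N"
  then obtain P where P: "P \<in> carrier_mat n n" "invertible_mat P" "P\<^sup>T * M * P = N"
    using M unfolding congruent_mat_def by auto
  then show "\<exists>P Q. mutually_inverse n P Q \<and> P\<^sup>T * M * P = N"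
    using invertible_mat_iff_mutually_inverse[OF P(1)] by auto
next
  assume "\<exists>P Q. mutually_inverse n P Q \<and> P\<^sup>T * M * P = N"
  then obtain P Q where P: "mutually_inverse n P Q" "P\<^sup>T * M * P = N" by blast
  note P' = mutually_inverseD[OF P(1)]
  have "invertible_mat P" using invertible_mat_iff_mutually_inverse[OF P'(1)] P(1) by blast
  moreover have "N \<in> carrier_mat n n" using P' P(2) M by auto
  ultimately show "congruent_mat M N" using P' P(2) M unfolding congruent_mat_def by blast
qed

lemma odd_summandI:
  assumes "M \<in> carrier_mat n n" "mutually_inverse n P Q" "P\<^sup>T * M * P = A \<oplus>\<^sub>m B"
    "A \<in> carrier_mat k k" "B \<in> carrier_mat m m" "odd k"
  shows "odd_summand M"
  using assms congruent_mat_iff[OF assms(1)] unfolding odd_summand_def by blast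

lemma odd_summandE:
  assumes "odd_summand M" "M \<in> carrier_mat n n"
  obtains P Q A B k m where "mutually_inverse n P Q" "P\<^sup>T * M * P = A \<oplus>\<^sub>m B"
    "A \<in> carrier_mat k k" "B \<in> carrier_mat m m" "odd k" "n = k + m"
proof -
  from assms(1) obtain k m A B where AB: "odd k" "A \<in> carrier_mat k k" "B \<in> carrier_mat m m" "congruent_mat M (A \<oplus>\<^sub>m B)"
    unfolding odd_summand_def by blast
  then obtain P Q where P: "mutually_inverse n P Q" "P\<^sup>T * M * P = A \<oplus>\<^sub>m B"
    using congruent_mat_iff[OF assms(2)] by blast
  have "n = k + m" using arg_cong[OF P(2), of dim_row] mutually_inverseD[OF P(1)] AB by simp
  with that P AB show ?thesis by blast
qed

text \<open>Congruence is transitive.\<close>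

lemma odd_summand_congruent:
  assumes M: "M \<in> carrier_mat n n" and P: "mutually_inverse n P Q" and odd: "odd_summand (P\<^sup>T * M * P)"
  shows "odd_summand M"
proof -
  note P' = mutually_inverseD[OF P]
  have "P\<^sup>T * M * P \<in> carrier_mat n n" using P' M by auto
  from odd_summandE[OF odd this] obtain P1 Q1 A B k m where P1: "mutually_inverse n P1 Q1"
    and e: "P1\<^sup>T * (P\<^sup>T * M * P) * P1 = A \<oplus>\<^sub>m B" and AB: "A \<in> carrier_mat k k" "B \<in> carrier_mat m m" "odd k" .
  have "(P * P1)\<^sup>T * M * (P * P1) = A \<oplus>\<^sub>m B"
    unfolding e[symmetric] using P' mutually_inverseD[OF P1] M by (simp add: block_simps)
  from odd_summandI[OF M mutually_inverse_mult[OF P P1] this AB] show ?thesis .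
qed

lemma direct_sum_assoc: "(A \<oplus>\<^sub>m B) \<oplus>\<^sub>m C = A \<oplus>\<^sub>m (B \<oplus>\<^sub>m C)"
  unfolding direct_sum_mat_def using assoc_four_block_mat[of A B C] by simp

lemma odd_summand_direct_sum_left:
  assumes "M1 \<in> carrier_mat n1 n1" "M2 \<in> carrier_mat n2 n2" "odd_summand M1"
  shows "odd_summand (M1 \<oplus>\<^sub>m M2)"
proof -
  from odd_summandE[OF assms(3,1)] obtain P Q A B k m where P: "mutually_inverse n1 P Q" "P\<^sup>T * M1 * P = A \<oplus>\<^sub>m B"
    and AB: "A \<in> carrier_mat k k" "B \<in> carrier_mat m m" "odd k" .
  note P' = mutually_inverseD[OF P(1)]
  have "(P \<oplus>\<^sub>m 1\<^sub>m n2)\<^sup>T * (M1 \<oplus>\<^sub>m M2) * (P \<oplus>\<^sub>m 1\<^sub>m n2) = A \<oplus>\<^sub>m (B \<oplus>\<^sub>m M2)"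
    using P' assms(1,2) P(2)
    by (simp add: direct_sum_transpose direct_sum_mult mult_one_left_dim mult_one_right_dim direct_sum_assoc)
  moreover have "B \<oplus>\<^sub>m M2 \<in> carrier_mat (m + n2) (m + n2)" "M1 \<oplus>\<^sub>m M2 \<in> carrier_mat (n1 + n2) (n1 + n2)" using AB assms by auto
  ultimately show ?thesis
    using odd_summandI[OF _ mutually_inverse_direct_sum[OF P(1) mutually_inverse_one[of n2]]] AB by blast
qed

lemma odd_summand_direct_sum_right:
  fixes M1 :: "'a :: field mat"
  assumes M: "M1 \<in> carrier_mat n1 n1" "M2 \<in> carrier_mat n2 n2" and odd: "odd_summand M2"
  shows "odd_summand (M1 \<oplus>\<^sub>m M2)"
proof -
  let ?P = "four_block_mat (0\<^sub>m n1 n2) (1\<^sub>m n1) (1\<^sub>m n2) (0\<^sub>m n2 n1) :: 'a mat"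
  have "mutually_inverse (n1 + n2) ?P ?P\<^sup>T"
    by (auto simp: mutually_inverse_def block_simps)
  moreover have "?P\<^sup>T * (M1 \<oplus>\<^sub>m M2) * ?P = M2 \<oplus>\<^sub>m M1"
    using M by (simp add: direct_sum_mat_def block_simps)
  moreover have "M1 \<oplus>\<^sub>m M2 \<in> carrier_mat (n1 + n2) (n1 + n2)" using M by auto
  ultimately show ?thesis
    using odd_summand_congruent odd_summand_direct_sum_left[OF M(2,1) odd] by metis
qed

lemma odd_size_odd_summand:
  assumes M: "M \<in> carrier_mat n n" and "odd n"
  shows "odd_summand M"
proof -
  have "(1\<^sub>m n)\<^sup>T * M * 1\<^sub>m n = M \<oplus>\<^sub>m 0\<^sub>m 0 0"
    using M by (simp add: block_simps) (rule eq_matI; simp add: direct_sum_mat_def)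
  from odd_summandI[OF M mutually_inverse_one this M zero_carrier_mat assms(2)] show ?thesis .
qed

text \<open>On two totally isotropic subspaces in direct sum the form is nothing but the pair \<open>(X, Y\<^sup>T)\<close>, and base changes in the two subspaces
  act on this pair independently. If the dimensions differ, the pair splits oddly; collecting the parts with index 1
  from both subspaces gives an orthogonal summand of odd size \<open>q1 + p1\<close>.\<close>

lemma odd_summand_hyperbolic:
  fixes X :: "'a :: field mat"
  assumes X: "X \<in> carrier_mat n1 n2" and Y: "Y \<in> carrier_mat n2 n1" and "n1 \<noteq> n2"
  shows "odd_summand (four_block_mat (0\<^sub>m n1 n1) X Y (0\<^sub>m n2 n2))"
proof -
  have "splits_oddly X Y\<^sup>T" using pencil_splits_oddly[OF X, of "Y\<^sup>T"] Y assms(3) by simp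
  then obtain P P' Q Q' q1 q2 p1 p2 X1 X2 Y1 Y2 where P: "mutually_inverse n1 P P'" and Q: "mutually_inverse n2 Q Q'"
    and n: "n1 = q1 + q2" "n2 = p1 + p2" "odd (p1 + q1)"
    and XY: "X1 \<in> carrier_mat q1 p1" "Y1 \<in> carrier_mat q1 p1" "X2 \<in> carrier_mat q2 p2" "Y2 \<in> carrier_mat q2 p2"
    and e: "P * X * Q = X1 \<oplus>\<^sub>m X2" "P * Y\<^sup>T * Q = Y1 \<oplus>\<^sub>m Y2"
    unfolding splits_oddly_def carrier_matD[OF X] by blast
  note P' = mutually_inverseD[OF P] and Q' = mutually_inverseD[OF Q]
  let ?H = "four_block_mat (0\<^sub>m n1 n1) X Y (0\<^sub>m n2 n2)"
  have H: "?H \<in> carrier_mat (n1 + n2) (n1 + n2)" by auto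
  let ?W = "P\<^sup>T \<oplus>\<^sub>m Q"
  have W: "mutually_inverse (n1 + n2) ?W (P'\<^sup>T \<oplus>\<^sub>m Q')"
    by (intro mutually_inverse_direct_sum mutually_inverse_transpose P Q)
  have "Q\<^sup>T * Y * P\<^sup>T = (P * Y\<^sup>T * Q)\<^sup>T" using P' Q' Y by (simp add: block_simps)
  then have e': "Q\<^sup>T * Y * P\<^sup>T = Y1\<^sup>T \<oplus>\<^sub>m Y2\<^sup>T" unfolding e(2) by (simp add: direct_sum_transpose)
  have "?W\<^sup>T * ?H * ?W = four_block_mat (0\<^sub>m n1 n1) (P * X * Q) (Q\<^sup>T * Y * P\<^sup>T) (0\<^sub>m n2 n2)"
    using P' Q' X Y by (simp add: direct_sum_mat_def block_simps)
  then have 1: "?W\<^sup>T * ?H * ?W = four_block_mat (0\<^sub>m n1 n1) (X1 \<oplus>\<^sub>m X2) (Y1\<^sup>T \<oplus>\<^sub>m Y2\<^sup>T) (0\<^sub>m n2 n2)"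
    unfolding e(1) e' .
  \<comment> \<open>permutation matrix that reorders coordinate blocks of sizes q1, q2, p1, p2 as q1, p1, q2, p2\<close>
  let ?P11 = "four_block_mat (1\<^sub>m q1) (0\<^sub>m q1 p1) (0\<^sub>m q2 q1) (0\<^sub>m q2 p1) :: 'a mat"
  let ?P12 = "four_block_mat (0\<^sub>m q1 q2) (0\<^sub>m q1 p2) (1\<^sub>m q2) (0\<^sub>m q2 p2) :: 'a mat"
  let ?P21 = "four_block_mat (0\<^sub>m p1 q1) (1\<^sub>m p1) (0\<^sub>m p2 q1) (0\<^sub>m p2 p1) :: 'a mat"
  let ?P22 = "four_block_mat (0\<^sub>m p1 q2) (0\<^sub>m p1 p2) (0\<^sub>m p2 q2) (1\<^sub>m p2) :: 'a mat"
  let ?S = "four_block_mat ?P11 ?P12 ?P21 ?P22"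
  have S: "?S \<in> carrier_mat (n1 + n2) (n1 + n2)" unfolding n by auto
  have "?S\<^sup>T * ?S = 1\<^sub>m (n1 + n2)" unfolding n by (simp add: block_simps) (simp add: ac_simps)
  then have S: "mutually_inverse (n1 + n2) ?S ?S\<^sup>T"
    using left_inverse_mutually_inverse[of "?S\<^sup>T" "n1 + n2" ?S] S mutually_inverse_sym by auto
  have 2: "?S\<^sup>T * (?W\<^sup>T * ?H * ?W) * ?S =
      four_block_mat (0\<^sub>m q1 q1) X1 Y1\<^sup>T (0\<^sub>m p1 p1) \<oplus>\<^sub>m four_block_mat (0\<^sub>m q2 q2) X2 Y2\<^sup>T (0\<^sub>m p2 p2)"
    unfolding 1 unfolding n using XY by (simp add: direct_sum_mat_def block_simps)
  have "?W\<^sup>T * ?H * ?W \<in> carrier_mat (n1 + n2) (n1 + n2)" using mutually_inverseD[OF W] H by auto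
  moreover have "odd (q1 + p1)" using n(3) by simp
  moreover have "four_block_mat (0\<^sub>m q1 q1) X1 Y1\<^sup>T (0\<^sub>m p1 p1) \<in> carrier_mat (q1 + p1) (q1 + p1)"
    "four_block_mat (0\<^sub>m q2 q2) X2 Y2\<^sup>T (0\<^sub>m p2 p2) \<in> carrier_mat (q2 + p2) (q2 + p2)" by auto
  ultimately have "odd_summand (?W\<^sup>T * ?H * ?W)" using odd_summandI[OF _ S 2] by blast
  from odd_summand_congruent[OF H W this] show ?thesis .
qed

section \<open>Powers, conjugation and intertwiners\<close>

lemma pow_mat_transpose:
  fixes A :: "'a :: comm_semiring_1 mat"
  assumes A: "A \<in> carrier_mat n n"
  shows "(A\<^sup>T) ^\<^sub>m k = (A ^\<^sub>m k)\<^sup>T"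
proof (induction k)
  case (Suc k)
  have "(A ^\<^sub>m Suc k)\<^sup>T = (A ^\<^sub>m k)\<^sup>T * A\<^sup>T"
    unfolding pow_mat_Suc_left[OF A] using A by (simp add: transpose_mult_dim)
  then show ?case using Suc by simp
qed (use A in simp)

lemma pow_mat_direct_sum:
  assumes "A \<in> carrier_mat n n" "B \<in> carrier_mat m m"
  shows "(A \<oplus>\<^sub>m B) ^\<^sub>m k = A ^\<^sub>m k \<oplus>\<^sub>m B ^\<^sub>m k"
  using pow_four_block_mat[OF assms, of k] assms by (simp add: direct_sum_mat_def)

lemma pow_mat_conjugate:
  fixes A :: "'a :: field mat"
  assumes A: "A \<in> carrier_mat n n" and P: "mutually_inverse n P Q"
  shows "(Q * A * P) ^\<^sub>m k = Q * A ^\<^sub>m k * P"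
proof (induction k)
  case 0
  show ?case using A mutually_inverseD[OF P] by (simp add: mult_one_right_dim)
next
  case (Suc k)
  then show ?case
    using A mutually_inverseD[OF P] mutually_inverse_cancel[OF P] by (simp add: mult_assoc_dim)
qed

lemma poly_mat_conjugate:
  fixes A :: "'a :: field mat"
  assumes A: "A \<in> carrier_mat n n" and P: "mutually_inverse n P Q"
  shows "poly_mat f (Q * A * P) = Q * poly_mat f A * P"
proof -
  note P' = mutually_inverseD[OF P]
  have QAP: "Q * A * P \<in> carrier_mat n n" using A P' by auto
  have "A * P = P * (Q * A * P)" using A P' mutually_inverse_cancel[OF P] by (simp add: mult_assoc_dim)
  from poly_mat_intertwine[OF A QAP P'(1) this] have "Q * (poly_mat f A * P) = Q * (P * poly_mat f (Q * A * P))" by simp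
  also have "\<dots> = poly_mat f (Q * A * P)"
    using mutually_inverse_cancel(2)[OF P, of "poly_mat f (Q * A * P)"] poly_mat_carrier[OF QAP, of f] by auto
  finally show ?thesis using A P' by (simp add: mult_assoc_dim)
qed

lemma pow_mat_commute:
  fixes A :: "'a :: semiring_1 mat"
  assumes A: "A \<in> carrier_mat n n" and B: "B \<in> carrier_mat n n" and "A * B = B * A"
  shows "A ^\<^sub>m k * B = B * A ^\<^sub>m k"
proof (induction k)
  case (Suc k)
  have "A ^\<^sub>m Suc k * B = A ^\<^sub>m k * B * A" using assms by (simp add: mult_assoc_dim)
  then show ?case using Suc assms by (simp add: mult_assoc_dim)
qed (use A B in \<open>simp add: mult_one_left_dim mult_one_right_dim\<close>)

lemma pow_mat_mult_commuting:
  fixes A :: "'a :: semiring_1 mat"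
  assumes A: "A \<in> carrier_mat n n" and B: "B \<in> carrier_mat n n" and AB: "A * B = B * A"
  shows "(A * B) ^\<^sub>m k = A ^\<^sub>m k * B ^\<^sub>m k"
proof (induction k)
  case (Suc k)
  have "(A * B) ^\<^sub>m Suc k = A ^\<^sub>m k * (B ^\<^sub>m k * A) * B" using Suc A B by (simp add: mult_assoc_dim)
  also have "B ^\<^sub>m k * A = A * B ^\<^sub>m k" using pow_mat_commute[OF B A] AB by simp
  finally show ?case using A B by (simp add: mult_assoc_dim)
qed (use A B in \<open>simp add: mult_one_left_dim\<close>)

lemma pow_mat_one: "1\<^sub>m n ^\<^sub>m k = (1\<^sub>m n :: 'a :: semiring_1 mat)"
  by (induction k) (auto simp: mult_one_right_dim)

lemma smult_eq_zero_mat: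
  fixes A :: "'a :: field mat"
  assumes "c \<cdot>\<^sub>m A = 0\<^sub>m n m" "c \<noteq> 0"
  shows "A = 0\<^sub>m n m"
proof -
  have "A = inverse c \<cdot>\<^sub>m (c \<cdot>\<^sub>m A)" using assms(2) by (intro eq_matI) auto
  also have "\<dots> = 0\<^sub>m n m" unfolding assms(1) by (intro eq_matI) auto
  finally show ?thesis .
qed

lemma commuting_left_commute:
  fixes A :: "'a :: semiring_0 mat"
  assumes "X \<in> carrier_mat n n" "A \<in> carrier_mat n n" "dim_row B = n" "X * A = A * X"
  shows "X * (A * B) = A * (X * B)"
proof -
  have "X * (A * B) = (X * A) * B" using assms(1-3) by (simp add: mult_assoc_dim)
  also have "\<dots> = A * (X * B)" unfolding assms(4) using assms(1-3) by (simp add: mult_assoc_dim)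
  finally show ?thesis .
qed

lemma commuting_mult:
  fixes A :: "'a :: semiring_0 mat"
  assumes "X \<in> carrier_mat n n" "A \<in> carrier_mat n n" "B \<in> carrier_mat n n" "X * A = A * X" "X * B = B * X"
  shows "X * (A * B) = (A * B) * X"
  using commuting_left_commute[OF assms(1,2) _ assms(4), of B] assms by (simp add: mult_assoc_dim)

text \<open>From \<open>Y T = U Y\<close> and \<open>T W = 1\<close> follows \<open>Y = U Y W = U\<^sup>2 Y W\<^sup>2 = \<dots>\<close>, which ends in 0.\<close>

lemma intertwiner_invertible_nilpotent_zero:
  fixes Y :: "'a :: field mat"
  assumes Y: "Y \<in> carrier_mat n m" and T: "mutually_inverse m T W" and U: "U \<in> carrier_mat n n"
    and nil: "U ^\<^sub>m N = 0\<^sub>m n n" and e: "Y * T = U * Y"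
  shows "Y = 0\<^sub>m n m"
proof -
  note T' = mutually_inverseD[OF T]
  have "U * (Y * W) = (U * Y) * W" using U Y T' by (simp add: mult_assoc_dim)
  also have "\<dots> = Y" unfolding e[symmetric] using Y T' by (simp add: mult_assoc_dim mult_one_right_dim)
  finally have step: "U * (Y * W) = Y" .
  have "U ^\<^sub>m k * (Y * W ^\<^sub>m k) = Y" for k
  proof (induction k)
    case (Suc k)
    have "U ^\<^sub>m Suc k * (Y * W ^\<^sub>m Suc k) = U ^\<^sub>m k * (U * (Y * W)) * W ^\<^sub>m k"
      unfolding pow_mat_Suc_left[OF T'(2)] using U Y T' by (simp add: mult_assoc_dim)
    then show ?case unfolding step using Suc U Y T' by (simp add: mult_assoc_dim)
  qed (use U Y T' in \<open>simp add: mult_one_left_dim mult_one_right_dim\<close>)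
  from this[of N] have "Y = 0\<^sub>m n n * (Y * W ^\<^sub>m N)" unfolding nil by simp
  also have "\<dots> = 0\<^sub>m n m" using Y T' by (simp add: mult_zero_left_dim)
  finally show ?thesis .
qed

lemma intertwiner_nilpotent_invertible_zero:
  fixes Y :: "'a :: field mat"
  assumes Y: "Y \<in> carrier_mat n m" and T: "mutually_inverse n T W" and U: "U \<in> carrier_mat m m"
    and nil: "U ^\<^sub>m N = 0\<^sub>m m m" and e: "Y * U = T * Y"
  shows "Y = 0\<^sub>m n m"
proof -
  have "Y\<^sup>T * T\<^sup>T = U\<^sup>T * Y\<^sup>T"
    using arg_cong[OF e, of transpose_mat] Y U mutually_inverseD[OF T] by (simp add: transpose_mult_dim)
  moreover have "(U\<^sup>T) ^\<^sub>m N = 0\<^sub>m m m" using pow_mat_transpose[OF U, of N] nil by simp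
  ultimately have "Y\<^sup>T = 0\<^sub>m m n"
    using intertwiner_invertible_nilpotent_zero[OF _ mutually_inverse_transpose[OF T], of "Y\<^sup>T" m "U\<^sup>T" N] Y U by simp
  then have "(Y\<^sup>T)\<^sup>T = (0\<^sub>m m n)\<^sup>T" by simp
  then show ?thesis by simp
qed

text \<open>This makes Fitting decompositions compatible with everything that commutes with, or is adjoint with respect to, the decomposed operator.\<close>

lemma intertwiner_block_diagonal:
  fixes X :: "'a :: field mat"
  assumes X: "X \<in> carrier_mat (n1 + n2) (n1 + n2)"
    and T: "T1 \<in> carrier_mat n1 n1" "T1 ^\<^sub>m N = 0\<^sub>m n1 n1" "mutually_inverse n2 T2 W"
    and U: "U1 \<in> carrier_mat n1 n1" "U1 ^\<^sub>m K = 0\<^sub>m n1 n1" "mutually_inverse n2 U2 V"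
    and e: "X * (T1 \<oplus>\<^sub>m T2) = (U1 \<oplus>\<^sub>m U2) * X"
  obtains X1 X2 where "X = X1 \<oplus>\<^sub>m X2" "X1 \<in> carrier_mat n1 n1" "X2 \<in> carrier_mat n2 n2"
proof -
  from block_split[OF X] obtain X11 X12 X21 X22 where Xe: "X = four_block_mat X11 X12 X21 X22"
    and Xc: "X11 \<in> carrier_mat n1 n1" "X12 \<in> carrier_mat n1 n2" "X21 \<in> carrier_mat n2 n1" "X22 \<in> carrier_mat n2 n2" .
  note T2' = mutually_inverseD[OF T(3)] and U2' = mutually_inverseD[OF U(3)]
  have "X12 * T2 = U1 * X12" "X21 * T1 = U2 * X21"
    using e Xc T(1) T2' U(1) U2' unfolding Xe direct_sum_mat_def by (simp_all add: block_simps)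
  then have "X12 = 0\<^sub>m n1 n2" "X21 = 0\<^sub>m n2 n1"
    using intertwiner_invertible_nilpotent_zero[OF Xc(2) T(3) U(1,2)] intertwiner_nilpotent_invertible_zero[OF Xc(3) U(3) T(1,2)] by auto
  then show ?thesis using that[of X11 X22] Xe Xc by (simp add: direct_sum_mat_def)
qed

text \<open>The kernel vector is found among the \<open>T\<^sup>j y\<close>, so an operator that commutes with \<open>T\<close> and annihilates \<open>y\<close> annihilates it too.\<close>

lemma nilpotent_kernel_vector:
  fixes T :: "'a :: field mat"
  assumes T: "T \<in> carrier_mat n n" "T ^\<^sub>m N = 0\<^sub>m n n" and y: "y \<in> carrier_mat n 1" "y \<noteq> 0\<^sub>m n 1"
  obtains j where "T ^\<^sub>m j * y \<noteq> 0\<^sub>m n 1" "T * (T ^\<^sub>m j * y) = 0\<^sub>m n 1"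
proof -
  define k where "k = (LEAST k. T ^\<^sub>m k * y = 0\<^sub>m n 1)"
  have "T ^\<^sub>m N * y = 0\<^sub>m n 1" using T y by (simp add: mult_zero_left_dim)
  then have k: "T ^\<^sub>m k * y = 0\<^sub>m n 1" unfolding k_def by (rule LeastI)
  have "k \<noteq> 0" using k T y by (auto simp: mult_one_left_dim)
  then obtain j where j: "k = Suc j" using not0_implies_Suc by blast
  have "T ^\<^sub>m j * y \<noteq> 0\<^sub>m n 1" using not_less_Least[of j "\<lambda>k. T ^\<^sub>m k * y = 0\<^sub>m n 1"] j unfolding k_def[symmetric] by simp
  moreover have "T * (T ^\<^sub>m j * y) = 0\<^sub>m n 1"
    using k T y unfolding j pow_mat_Suc_left[OF T(1)] by (simp add: mult_assoc_dim)
  ultimately show ?thesis using that by blast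
qed

lemma det_direct_sum:
  fixes A :: "'a :: field mat"
  assumes "A \<in> carrier_mat n n" "B \<in> carrier_mat m m"
  shows "det (A \<oplus>\<^sub>m B) = det A * det B"
  using assms det_four_block_mat_lower_left_zero[of A n "0\<^sub>m n m" m "0\<^sub>m m n" B] by (simp add: direct_sum_mat_def)

lemma det_conjugate:
  fixes A :: "'a :: field mat"
  assumes A: "A \<in> carrier_mat n n" and P: "mutually_inverse n P Q"
  shows "det (Q * A * P) = det A"
proof -
  note P' = mutually_inverseD[OF P]
  have "det (Q * A * P) = det Q * det A * det P" using A P' det_mult[of "Q * A" n P] det_mult[of Q n A] by auto
  then show ?thesis using mutually_inverse_unique_det[OF P] by (simp add: algebra_simps)
qed

section \<open>Isometries\<close>

text \<open>For a self-adjoint operator the Fitting decomposition is an orthogonal one.\<close>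

lemma fitting_splits_bilinear_form:
  fixes M :: "'a :: field mat"
  assumes T: "T \<in> carrier_mat n n" and M: "M \<in> carrier_mat n n" and adj: "T\<^sup>T * M = M * T"
    and P: "mutually_inverse n P Q" and n: "n = n1 + n2"
    and T12: "T1 \<in> carrier_mat n1 n1" "T1 ^\<^sub>m N = 0\<^sub>m n1 n1" "mutually_inverse n2 T2 W" "Q * T * P = T1 \<oplus>\<^sub>m T2"
  obtains M1 M2 where "P\<^sup>T * M * P = M1 \<oplus>\<^sub>m M2" "M1 \<in> carrier_mat n1 n1" "M2 \<in> carrier_mat n2 n2"
proof -
  note P' = mutually_inverseD[OF P]
  have c: "P\<^sup>T * M * P \<in> carrier_mat (n1 + n2) (n1 + n2)" using P' M n by auto
  have "(T1\<^sup>T \<oplus>\<^sub>m T2\<^sup>T) * (P\<^sup>T * M * P) = (Q * T * P)\<^sup>T * (P\<^sup>T * M * P)"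
    unfolding T12(4) by (simp add: direct_sum_transpose)
  also have "\<dots> = P\<^sup>T * (T\<^sup>T * M) * P"
    using P' T M mutually_inverse_cancel[OF mutually_inverse_transpose[OF P]] by (simp add: block_simps)
  also have "\<dots> = (P\<^sup>T * M * P) * (Q * T * P)"
    unfolding adj using P' T M mutually_inverse_cancel[OF P] by (simp add: block_simps)
  finally have e: "(P\<^sup>T * M * P) * (T1 \<oplus>\<^sub>m T2) = (T1\<^sup>T \<oplus>\<^sub>m T2\<^sup>T) * (P\<^sup>T * M * P)" unfolding T12(4) by simp
  have "(T1\<^sup>T) ^\<^sub>m N = 0\<^sub>m n1 n1" using pow_mat_transpose[OF T12(1), of N] T12(2) by simp
  from intertwiner_block_diagonal[OF c T12(1-3) _ this mutually_inverse_transpose[OF T12(3)] e] T12(1) that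
  show ?thesis by auto
qed

lemma fitting_splits_commuting:
  fixes S :: "'a :: field mat"
  assumes T: "T \<in> carrier_mat n n" and S: "S \<in> carrier_mat n n" and comm: "S * T = T * S"
    and P: "mutually_inverse n P Q" and n: "n = n1 + n2"
    and T12: "T1 \<in> carrier_mat n1 n1" "T1 ^\<^sub>m N = 0\<^sub>m n1 n1" "mutually_inverse n2 T2 W" "Q * T * P = T1 \<oplus>\<^sub>m T2"
  obtains S1 S2 where "Q * S * P = S1 \<oplus>\<^sub>m S2" "S1 \<in> carrier_mat n1 n1" "S2 \<in> carrier_mat n2 n2"
proof -
  note P' = mutually_inverseD[OF P]
  have c: "Q * S * P \<in> carrier_mat (n1 + n2) (n1 + n2)" using P' S n by auto
  have "(Q * S * P) * (Q * T * P) = Q * (S * T) * P" using P' S T mutually_inverse_cancel[OF P] by (simp add: block_simps)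
  also have "\<dots> = (Q * T * P) * (Q * S * P)"
    unfolding comm using P' S T mutually_inverse_cancel[OF P] by (simp add: block_simps)
  finally have e: "(Q * S * P) * (T1 \<oplus>\<^sub>m T2) = (T1 \<oplus>\<^sub>m T2) * (Q * S * P)" unfolding T12(4) .
  from intertwiner_block_diagonal[OF c T12(1-3) T12(1-3) e] that show ?thesis by metis
qed

text \<open>An isometry is adjoint to its inverse. This holds without cancelling the form, so the form may be degenerate.\<close>

lemma isometry_adjoint:
  fixes M :: "'a :: field mat"
  assumes M: "M \<in> carrier_mat n n" and SR: "mutually_inverse n S R" and iso: "S\<^sup>T * M * S = M"
  shows "S\<^sup>T * M = M * R" "R\<^sup>T * M = M * S"
proof -
  note SR' = mutually_inverseD[OF SR]
  have "S\<^sup>T * M = S\<^sup>T * M * (S * R)" using SR' M by (simp add: mult_one_right_dim)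
  also have "\<dots> = (S\<^sup>T * M * S) * R" using SR' M by (simp add: mult_assoc_dim)
  finally show 1: "S\<^sup>T * M = M * R" unfolding iso .
  have "R\<^sup>T * M = R\<^sup>T * (S\<^sup>T * M * S)" unfolding iso ..
  also have "\<dots> = M * S"
    using SR' M mutually_inverse_cancel(2)[OF mutually_inverse_transpose[OF SR], of "M * S"] by (simp add: mult_assoc_dim)
  finally show "R\<^sup>T * M = M * S" .
qed

lemma poly_isometry_adjoint:
  fixes M :: "'a :: field mat"
  assumes M: "M \<in> carrier_mat n n" and SR: "mutually_inverse n S R" and iso: "S\<^sup>T * M * S = M"
  shows "(poly_mat f S)\<^sup>T * M = M * poly_mat f R" "(poly_mat f R)\<^sup>T * M = M * poly_mat f S"
  using poly_mat_intertwine[of "S\<^sup>T" n R n M f] poly_mat_intertwine[of "R\<^sup>T" n S n M f]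
    isometry_adjoint[OF M SR iso] mutually_inverseD[OF SR] M by (auto simp: poly_mat_transpose)

lemma isometry_direct_sum_det:
  fixes M1 :: "'a :: field mat"
  assumes IH1: "\<And>S R. mutually_inverse n1 S R \<Longrightarrow> S\<^sup>T * M1 * S = M1 \<Longrightarrow> det S = 1"
    and IH2: "\<And>S R. mutually_inverse n2 S R \<Longrightarrow> S\<^sup>T * M2 * S = M2 \<Longrightarrow> det S = 1"
    and M: "M1 \<in> carrier_mat n1 n1" "M2 \<in> carrier_mat n2 n2"
    and S: "S1 \<in> carrier_mat n1 n1" "S2 \<in> carrier_mat n2 n2"
    and det: "det (S1 \<oplus>\<^sub>m S2) \<noteq> 0" and iso: "(S1 \<oplus>\<^sub>m S2)\<^sup>T * (M1 \<oplus>\<^sub>m M2) * (S1 \<oplus>\<^sub>m S2) = M1 \<oplus>\<^sub>m M2"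
  shows "det (S1 \<oplus>\<^sub>m S2) = 1"
proof -
  have "S1\<^sup>T * M1 * S1 = M1" "S2\<^sup>T * M2 * S2 = M2"
    using iso M S by (simp_all add: direct_sum_transpose direct_sum_mult direct_sum_inject)
  moreover have "det S1 \<noteq> 0" "det S2 \<noteq> 0" using det S by (simp_all add: det_direct_sum)
  ultimately have "det S1 = 1" "det S2 = 1"
    using IH1 IH2 mutually_inverse_if_det[OF S(1)] mutually_inverse_if_det[OF S(2)] by metis+
  then show ?thesis using S by (simp add: det_direct_sum)
qed

text \<open>A monic polynomial of least degree among all \<open>f \<noteq> 0\<close> for which \<open>f(S)\<close> is singular. It replaces an irreducible factor of the
  characteristic polynomial: division with remainder shows that whatever annihilates a nonzero vector of the kernel
  of \<open>p(S)\<close> is divisible by \<open>p\<close>, and from this \<open>p\<close> is prime. The matrix \<open>R\<close> is the inverse of \<open>S\<close>.\<close>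

locale minimal_singular_poly =
  fixes n :: nat and S R :: "'a :: field mat" and p :: "'a poly"
  assumes SR: "mutually_inverse n S R"
    and monic: "lead_coeff p = 1"
    and singular: "\<exists>x \<in> carrier_mat n 1. x \<noteq> 0\<^sub>m n 1 \<and> poly_mat p S * x = 0\<^sub>m n 1"
    and minimal: "\<And>f x. x \<in> carrier_mat n 1 \<Longrightarrow> x \<noteq> 0\<^sub>m n 1 \<Longrightarrow> poly_mat f S * x = 0\<^sub>m n 1 \<Longrightarrow> f \<noteq> 0 \<Longrightarrow> degree p \<le> degree f"
begin

lemmas SR' = mutually_inverseD[OF SR]

lemma p_nonzero: "p \<noteq> 0"
  using monic by auto

lemma kernel_divides:
  assumes x: "x \<in> carrier_mat n 1" "x \<noteq> 0\<^sub>m n 1" "poly_mat p S * x = 0\<^sub>m n 1" and f: "poly_mat f S * x = 0\<^sub>m n 1"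
  shows "p dvd f"
proof -
  have "f = (f div p) * p + f mod p" by simp
  then have "poly_mat f S * x = (poly_mat (f div p) S * poly_mat p S + poly_mat (f mod p) S) * x"
    by (metis poly_mat_add[OF SR'(1)] poly_mat_mult[OF SR'(1)])
  also have "\<dots> = poly_mat (f div p) S * (poly_mat p S * x) + poly_mat (f mod p) S * x"
    using SR' x(1) by (simp add: mult_add_left_dim mult_assoc_dim)
  also have "\<dots> = poly_mat (f mod p) S * x"
    using SR' x by (simp add: mult_zero_right_dim add_zero_left_dim)
  finally have "poly_mat (f mod p) S * x = 0\<^sub>m n 1" using f by simp
  from minimal[OF x(1,2) this] have "f mod p = 0" using degree_mod_less[OF p_nonzero, of f] by linarith
  then show ?thesis by (simp add: mod_eq_0_iff_dvd)
qed

lemma degree_pos: "degree p > 0"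
proof (rule ccontr)
  assume "\<not> degree p > 0"
  then have "p = 1" using monic by (auto elim!: degree_eq_zeroE simp: one_pCons)
  obtain x where x: "x \<in> carrier_mat n 1" "x \<noteq> 0\<^sub>m n 1" "poly_mat p S * x = 0\<^sub>m n 1" using singular by blast
  have "poly_mat (p ^ 0) S = 1\<^sub>m n" using SR' by (subst poly_mat_power) auto
  then show False using x \<open>p = 1\<close> by (simp add: mult_one_left_dim)
qed

lemma prime: "prime_elem p"
proof (rule prime_elemI)
  show "p \<noteq> 0" by (rule p_nonzero)
  show "\<not> is_unit p" using degree_pos by (simp add: is_unit_iff_degree p_nonzero)
  fix a b assume "p dvd a * b"
  then obtain c where c: "a * b = p * c" by (rule dvdE)
  obtain x where x: "x \<in> carrier_mat n 1" "x \<noteq> 0\<^sub>m n 1" "poly_mat p S * x = 0\<^sub>m n 1" using singular by blast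
  have swap: "poly_mat f S * (poly_mat g S * x) = poly_mat (f * g) S * x" for f g
    using SR' x(1) by (simp add: poly_mat_mult mult_assoc_dim)
  show "p dvd a \<or> p dvd b"
  proof (cases "poly_mat b S * x = 0\<^sub>m n 1")
    case True
    then show ?thesis using kernel_divides[OF x] by blast
  next
    case False
    have "poly_mat p S * (poly_mat b S * x) = poly_mat b S * (poly_mat p S * x)" unfolding swap by (simp only: mult.commute)
    also have "\<dots> = 0\<^sub>m n 1" using x SR' by (simp add: mult_zero_right_dim)
    finally have pb: "poly_mat p S * (poly_mat b S * x) = 0\<^sub>m n 1" .
    have "poly_mat a S * (poly_mat b S * x) = poly_mat c S * (poly_mat p S * x)" unfolding swap c by (simp only: mult.commute)
    also have "\<dots> = 0\<^sub>m n 1" using x SR' by (simp add: mult_zero_right_dim)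
    finally have "poly_mat a S * (poly_mat b S * x) = 0\<^sub>m n 1" .
    moreover have "poly_mat b S * x \<in> carrier_mat n 1" using poly_mat_carrier[OF SR'(1), of b] x by auto
    ultimately have "p dvd a" using kernel_divides False pb by blast
    then show ?thesis by blast
  qed
qed

lemma coeff_0_nonzero: "coeff p 0 \<noteq> 0"
proof
  assume "coeff p 0 = 0"
  then obtain g where g: "p = pCons 0 g" by (cases p) auto
  obtain x where x: "x \<in> carrier_mat n 1" "x \<noteq> 0\<^sub>m n 1" "poly_mat p S * x = 0\<^sub>m n 1" using singular by blast
  have "0 \<cdot>\<^sub>m 1\<^sub>m n + S * poly_mat g S = S * poly_mat g S" using SR' by (intro eq_matI) (auto simp del: index_mult_mat(1))
  then have "S * (poly_mat g S * x) = 0\<^sub>m n 1"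
    using x SR' unfolding g by (simp add: poly_mat_pCons mult_assoc_dim)
  then have "R * (S * (poly_mat g S * x)) = R * 0\<^sub>m n 1" by simp
  then have "poly_mat g S * x = 0\<^sub>m n 1"
    using mutually_inverse_cancel(2)[OF SR, of "poly_mat g S * x"] SR' by (simp add: mult_zero_right_dim)
  moreover have "g \<noteq> 0" using p_nonzero g by auto
  ultimately show False using minimal[OF x(1,2), of g] g by simp
qed

end

text \<open>Every nonzero vector is annihilated by a nonzero polynomial in \<open>S\<close>, so candidates exist; one of least degree is scaled to be monic.\<close>

lemma minimal_singular_poly_exists:
  fixes S :: "'a :: field mat"
  assumes SR: "mutually_inverse n S R" and "n > 0"
  obtains p where "minimal_singular_poly n S R p"
proof -
  note SR' = mutually_inverseD[OF SR]
  define kills where "kills f \<longleftrightarrow> f \<noteq> 0 \<and> (\<exists>x \<in> carrier_mat n 1. x \<noteq> 0\<^sub>m n 1 \<and> poly_mat f S * x = 0\<^sub>m n 1)" for f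
  let ?v = "mat n 1 (\<lambda>_. 1) :: 'a mat"
  have v: "?v \<in> carrier_mat n 1" by simp
  have "?v $$ (0, 0) \<noteq> 0\<^sub>m n 1 $$ (0, 0)" using assms(2) by simp
  then have "?v \<noteq> 0\<^sub>m n 1" by metis
  then have "\<exists>f. kills f" using annihilating_poly_exists[OF SR'(1) v] v unfolding kills_def by metis
  then obtain f where f: "kills f" "\<And>g. kills g \<Longrightarrow> degree f \<le> degree g"
    using ex_has_least_nat[of kills _ degree] by blast
  let ?p = "smult (inverse (lead_coeff f)) f"
  have f0: "f \<noteq> 0" using f(1) by (simp add: kills_def)
  have "minimal_singular_poly n S R ?p"
  proof
    show "lead_coeff ?p = 1" using f0 by simp
    obtain x where x: "x \<in> carrier_mat n 1" "x \<noteq> 0\<^sub>m n 1" "poly_mat f S * x = 0\<^sub>m n 1" using f(1) unfolding kills_def by blast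
    have "poly_mat ?p S * x = inverse (lead_coeff f) \<cdot>\<^sub>m (poly_mat f S * x)"
      using SR' x(1) by (simp add: poly_mat_smult smult_left_dim)
    then have "poly_mat ?p S * x = 0\<^sub>m n 1" using x by (auto intro!: eq_matI)
    then show "\<exists>x \<in> carrier_mat n 1. x \<noteq> 0\<^sub>m n 1 \<and> poly_mat ?p S * x = 0\<^sub>m n 1" using x by blast
  next
    fix g x assume "x \<in> carrier_mat n 1" "x \<noteq> 0\<^sub>m n 1" "poly_mat g S * x = 0\<^sub>m n 1" "g \<noteq> 0"
    then have "kills g" unfolding kills_def by blast
    then show "degree ?p \<le> degree g" using f(2) f0 by simp
  qed (rule SR)
  then show ?thesis by (rule that)
qed

context minimal_singular_poly
begin

text \<open>A common kernel vector of \<open>p(S)\<close> and \<open>p(R)\<close> is annihilated by \<open>p\<close> and by the reflected polynomial, so these agree up to the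
  factor \<open>c = p(0)\<close>, and reflecting twice gives \<open>c\<^sup>2 = 1\<close>. Then \<open>p(S)\<close> is nilpotent, and the determinant is a power of \<open>(-1)\<^sup>d c\<close>.
  For \<open>c = 1\<close> the parity of \<open>n\<close> decides; otherwise the polynomial vanishes at 1, so \<open>p = x - 1\<close>.\<close>

lemma det_of_self_reciprocal:
  assumes y: "y \<in> carrier_mat n 1" "y \<noteq> 0\<^sub>m n 1" "poly_mat p S * y = 0\<^sub>m n 1" "poly_mat p R * y = 0\<^sub>m n 1"
    and nil: "(poly_mat p S * poly_mat p R) ^\<^sub>m N = 0\<^sub>m n n" and "even n"
  shows "det S = 1"
proof -
  define c where "c = coeff p 0"
  have "poly_mat (reflect_poly p) S * y = S ^\<^sub>m degree p * (poly_mat p R * y)"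
    unfolding poly_mat_reflect[OF SR, symmetric] using SR' y(1) by (simp add: mult_assoc_dim)
  also have "\<dots> = 0\<^sub>m n 1" using y SR' by (simp add: mult_zero_right_dim)
  finally obtain k where k: "reflect_poly p = p * k" using kernel_divides[OF y(1-3)] by (blast elim: dvdE)
  have "k \<noteq> 0" using k p_nonzero by auto
  then have "degree p + degree k = degree p"
    using arg_cong[OF k, of degree] coeff_0_nonzero p_nonzero by (simp add: degree_mult_eq)
  then obtain a where a: "k = [:a:]" by (auto elim: degree_eq_zeroE)
  have refl: "reflect_poly p = smult a p" using k a by simp
  have "a * c = 1" using arg_cong[OF refl, of "\<lambda>q. coeff q 0"] monic by (simp add: c_def)
  moreover have "coeff (reflect_poly p) (degree p) = c" by (simp add: coeff_reflect_poly c_def)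
  then have ac: "a = c" using refl monic by simp
  ultimately have cc: "c * c = 1" by simp
  have "c \<noteq> 0" using cc by auto
  let ?A = "poly_mat p S" and ?B = "poly_mat p R"
  have AB: "?A \<in> carrier_mat n n" "?B \<in> carrier_mat n n" using SR' by (auto intro: poly_mat_carrier)
  \<comment> \<open>Since S^d * p(R) is the reflected polynomial at S, S^d * p(S) * p(R) = c * p(S)^2, and all factors commute.\<close>
  have "S * R = R * S" using SR' by simp
  then have BS: "?B * S = S * ?B" using poly_mat_intertwine[of R n R n S p] SR' by simp
  have AS: "?A * S = S * ?A" using poly_mat_intertwine[of S n S n S p] SR' by simp
  have "S * (?A * ?B) = (?A * ?B) * S"
    using commuting_mult[OF SR'(1) AB] AS BS by simp
  then have comm: "S ^\<^sub>m degree p * (?A * ?B) = (?A * ?B) * S ^\<^sub>m degree p"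
    using pow_mat_commute[of S n "?A * ?B" "degree p"] SR' AB by auto
  have "S ^\<^sub>m degree p * ?A = ?A * S ^\<^sub>m degree p"
    using pow_mat_commute[of S n ?A "degree p"] SR' AB AS by auto
  then have "S ^\<^sub>m degree p * (?A * ?B) = ?A * (S ^\<^sub>m degree p * ?B)"
    using commuting_left_commute[of "S ^\<^sub>m degree p" n ?A ?B] SR' AB by simp
  also have "\<dots> = poly_mat (smult c (p * p)) S"
    unfolding poly_mat_reflect[OF SR] refl ac poly_mat_smult[OF SR'(1)] poly_mat_mult[OF SR'(1)]
    using AB by (simp add: smult_right_dim)
  finally have "poly_mat (smult c (p * p)) S ^\<^sub>m N = (S ^\<^sub>m degree p * (?A * ?B)) ^\<^sub>m N" by simp
  also have "\<dots> = (S ^\<^sub>m degree p) ^\<^sub>m N * (?A * ?B) ^\<^sub>m N"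
    using pow_mat_mult_commuting[OF _ _ comm, of n N] SR' AB by simp
  also have "\<dots> = 0\<^sub>m n n" unfolding nil using SR' by (simp add: mult_zero_right_dim)
  finally have "poly_mat (smult c (p * p) ^ N) S = 0\<^sub>m n n" using SR' by (simp add: poly_mat_power)
  then have "c ^ N \<cdot>\<^sub>m poly_mat ((p * p) ^ N) S = 0\<^sub>m n n" using SR' by (simp add: poly_mat_smult smult_power)
  moreover have "c ^ N \<noteq> 0" using \<open>c \<noteq> 0\<close> by simp
  ultimately have "poly_mat ((p * p) ^ N) S = 0\<^sub>m n n" by (rule smult_eq_zero_mat)
  then have "?A ^\<^sub>m (2 * N) = 0\<^sub>m n n" using SR' by (simp add: poly_mat_power[symmetric] power_mult power2_eq_square)
  from det_of_primary_mat[OF SR'(1) prime monic this] obtain m where m: "n = degree p * m" "det S = ((-1) ^ degree p * c) ^ m"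
    unfolding c_def by blast
  show ?thesis
  proof (cases "c = 1")
    case True
    then have "det S = (-1) ^ n" using m by (simp add: power_mult)
    then show ?thesis using \<open>even n\<close> by simp
  next
    case False
    then have c1: "c = -1" using cc square_eq_1_iff by blast
    have "poly p 1 = c * poly p 1"
      using poly_reflect_poly_nz[of 1 p] unfolding refl ac by simp
    then have "poly p 1 = 0" using False by (simp add: algebra_simps) 
    then have "[:-1, 1:] dvd p" by (simp add: poly_eq_0_iff_dvd)
    then obtain q where q: "p = [:-1, 1:] * q" by (rule dvdE)
    then have q0: "q \<noteq> 0" using p_nonzero by auto
    then have dq: "degree p = Suc (degree q)" unfolding q by (subst degree_mult_eq) auto
    then have "\<not> p dvd q" using dvd_imp_degree_le[of p q] q0 by auto
    then have "p dvd [:-1, 1:]" using prime_elem_dvd_mult_iff[OF prime, of "[:-1, 1:]" q] q by auto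
    then have "degree p \<le> 1" using dvd_imp_degree_le[of p "[:-1, 1:]"] by simp
    then have "degree p = 1" using degree_pos by simp
    then show ?thesis using m(2) c1 by simp
  qed
qed

text \<open>Let \<open>V1\<close> and \<open>V2\<close> be the parts of the space on which \<open>p(S)\<close> is nilpotent and invertible, respectively. Then \<open>p(R)\<close> is invertible on \<open>V1\<close>
  (otherwise there would be a common kernel vector) and nilpotent on \<open>V2\<close>. As \<open>p(S)\<close> and \<open>p(R)\<close> are adjoint, both parts are totally isotropic.
  If their dimensions differ, the form has an odd summand. If they agree, \<open>S\<close> on \<open>V1\<close> and \<open>R\<close> on \<open>V2\<close> are
  \<open>p\<close>-primary of the same size and have the same determinant, so the contributions of \<open>V1\<close> and \<open>V2\<close> to \<open>det S\<close> cancel.\<close>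

lemma det_of_isotropic_splitting:
  assumes M: "M \<in> carrier_mat n n" and iso: "S\<^sup>T * M * S = M"
    and nil: "(poly_mat p S * poly_mat p R) ^\<^sub>m N = 0\<^sub>m n n"
    and disj: "\<And>y. y \<in> carrier_mat n 1 \<Longrightarrow> poly_mat p S * y = 0\<^sub>m n 1 \<Longrightarrow> poly_mat p R * y = 0\<^sub>m n 1 \<Longrightarrow> y = 0\<^sub>m n 1"
    and no: "\<not> odd_summand M"
  shows "det S = 1"
proof -
  let ?A = "poly_mat p S" and ?B = "poly_mat p R"
  have AB: "?A \<in> carrier_mat n n" "?B \<in> carrier_mat n n" using SR' by (auto intro: poly_mat_carrier)
  obtain P Q n1 n2 T1 T2 K W where P: "mutually_inverse n P Q" and n: "n = n1 + n2"
    and T: "T1 \<in> carrier_mat n1 n1" "T1 ^\<^sub>m K = 0\<^sub>m n1 n1" "mutually_inverse n2 T2 W" "Q * ?A * P = T1 \<oplus>\<^sub>m T2"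
    using fitting_decomposition[OF AB(1)] by blast
  note P' = mutually_inverseD[OF P] and T2' = mutually_inverseD[OF T(3)]
  have "S * ?A = ?A * S" using poly_mat_intertwine[of S n S n S p] SR' by simp
  from fitting_splits_commuting[OF AB(1) SR'(1) this P n T] obtain S1 S2 where
    S12: "Q * S * P = S1 \<oplus>\<^sub>m S2" "S1 \<in> carrier_mat n1 n1" "S2 \<in> carrier_mat n2 n2" .
  have "R * ?A = ?A * R" using poly_mat_intertwine[of S n S n R p] SR' by simp
  from fitting_splits_commuting[OF AB(1) SR'(2) this P n T] obtain R1 R2 where
    R12: "Q * R * P = R1 \<oplus>\<^sub>m R2" "R1 \<in> carrier_mat n1 n1" "R2 \<in> carrier_mat n2 n2" .
  have "(Q * S * P) * (Q * R * P) = Q * (S * R) * P"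
    using P' SR' mutually_inverse_cancel[OF P] mutually_inverse_cancel[OF SR] by (simp add: mult_assoc_dim mult_one_left_dim)
  also have "\<dots> = 1\<^sub>m n" using SR' P' by (simp add: mult_one_right_dim)
  finally have "(S1 * R1) \<oplus>\<^sub>m (S2 * R2) = 1\<^sub>m n1 \<oplus>\<^sub>m 1\<^sub>m n2"
    unfolding S12(1) R12(1) using S12 R12 n by (simp add: direct_sum_mult)
  then have "S1 * R1 = 1\<^sub>m n1" "S2 * R2 = 1\<^sub>m n2" using S12 R12 by (simp_all add: direct_sum_inject del: direct_sum_one)
  then have SR1: "mutually_inverse n1 S1 R1" and SR2: "mutually_inverse n2 S2 R2"
    using left_inverse_mutually_inverse S12 R12 by blast+
  let ?U1 = "poly_mat p R1" and ?U2 = "poly_mat p R2"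
  have U: "?U1 \<in> carrier_mat n1 n1" "?U2 \<in> carrier_mat n2 n2" using R12 by (auto intro: poly_mat_carrier)
  have "T1 \<oplus>\<^sub>m T2 = poly_mat p S1 \<oplus>\<^sub>m poly_mat p S2"
    using poly_mat_conjugate[OF SR'(1) P, of p] unfolding S12(1) T(4) using S12 by (simp add: poly_mat_direct_sum)
  then have TS: "poly_mat p S1 = T1" "poly_mat p S2 = T2"
    using S12 T T2' by (simp_all add: direct_sum_inject)
  have QB: "Q * ?B * P = ?U1 \<oplus>\<^sub>m ?U2"
    using poly_mat_conjugate[OF SR'(2) P, of p] unfolding R12(1) using R12 by (simp add: poly_mat_direct_sum)
  have "injective_mat ?U1"
    unfolding injective_mat_iff[OF U(1)]
  proof (intro ballI impI, rule ccontr)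
    fix y assume y: "y \<in> carrier_mat n1 1" "?U1 * y = 0\<^sub>m n1 1" "y \<noteq> 0\<^sub>m n1 1"
    from nilpotent_kernel_vector[OF T(1,2) y(1,3)] obtain j where j: "T1 ^\<^sub>m j * y \<noteq> 0\<^sub>m n1 1" "T1 * (T1 ^\<^sub>m j * y) = 0\<^sub>m n1 1" .
    let ?z = "T1 ^\<^sub>m j * y"
    have z: "?z \<in> carrier_mat n1 1" using T(1) y(1) by auto
    have "R1 * T1 = T1 * R1"
      using poly_mat_intertwine[of S1 n1 S1 n1 R1 p] S12 R12 mutually_inverseD[OF SR1] unfolding TS by simp
    then have "?U1 * T1 = T1 * ?U1" using poly_mat_intertwine[of R1 n1 R1 n1 T1 p] R12(2) T(1) by simp
    then have "?U1 * T1 ^\<^sub>m j = T1 ^\<^sub>m j * ?U1" using pow_mat_commute[OF T(1) U(1), of j] by simp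
    then have "?U1 * ?z = T1 ^\<^sub>m j * (?U1 * y)"
      using commuting_left_commute[OF U(1), of "T1 ^\<^sub>m j" y] T(1) y(1) by simp
    then have Uz: "?U1 * ?z = 0\<^sub>m n1 1" using y T(1) by (simp add: mult_zero_right_dim)
    \<comment> \<open>?z is a common kernel vector in V1; padded with zeros it becomes one of the whole space\<close>
    let ?x = "P * vcat ?z (0\<^sub>m n2 1)"
    have v: "vcat ?z (0\<^sub>m n2 1) \<in> carrier_mat n 1"
      by (intro carrier_matI) (use T(1) y(1) n in simp_all)
    have x: "?x \<in> carrier_mat n 1" by (rule mult_carrier_mat[OF P'(1) v])
    have lift: "X * ?x = 0\<^sub>m n 1" if X: "X \<in> carrier_mat n n" "Q * X * P = X1 \<oplus>\<^sub>m X2" "X1 * ?z = 0\<^sub>m n1 1"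
        "X1 \<in> carrier_mat n1 n1" "X2 \<in> carrier_mat n2 n2" for X X1 X2
    proof -
      have "X * (P * w) = P * ((Q * X * P) * w)" if "dim_row w = n" for w
        using X(1) P' that mutually_inverse_cancel[OF P] by (simp add: mult_assoc_dim)
      then have "X * ?x = P * ((Q * X * P) * vcat ?z (0\<^sub>m n2 1))" using v by blast
      also have "(Q * X * P) * vcat ?z (0\<^sub>m n2 1) = vcat (X1 * ?z) (X2 * 0\<^sub>m n2 1)"
        unfolding X(2) using X(4,5) T(1) y(1) by (simp add: direct_sum_mult_vcat)
      also have "\<dots> = 0\<^sub>m n 1" unfolding X(3) using X(5) n by (simp add: mult_zero_right_dim)
      finally show ?thesis using P' by (simp add: mult_zero_right_dim)
    qed
    have "?x = 0\<^sub>m n 1"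
      using disj[OF x] lift[OF AB(1) T(4) j(2) T(1) T2'(1)] lift[OF AB(2) QB Uz U] by blast
    then have "Q * ?x = Q * 0\<^sub>m n 1" by simp
    then have "vcat ?z (0\<^sub>m n2 1) = 0\<^sub>m n 1"
      using mutually_inverse_cancel(2)[OF P carrier_matD(1)[OF v]] P' by (simp add: mult_zero_right_dim)
    then have "vcat ?z (0\<^sub>m n2 1) = vcat (0\<^sub>m n1 1) (0\<^sub>m n2 1)" using n by simp
    then have "?z = 0\<^sub>m n1 1" using z by (subst (asm) vcat_inject) auto
    then show False using j(1) by simp
  qed
  then obtain V where V: "mutually_inverse n1 ?U1 V" using injective_mat_invertible[OF U(1)] by blast
  have U2nil: "?U2 ^\<^sub>m N = 0\<^sub>m n2 n2"
  proof -
    have "Q * (?A * ?B) * P = (Q * ?A * P) * (Q * ?B * P)"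
      using P' AB mutually_inverse_cancel[OF P] by (simp add: mult_assoc_dim)
    also have "\<dots> = (T1 * ?U1) \<oplus>\<^sub>m (T2 * ?U2)" unfolding T(4) QB using T T2' U by (simp add: direct_sum_mult)
    finally have "(T1 * ?U1) ^\<^sub>m N \<oplus>\<^sub>m (T2 * ?U2) ^\<^sub>m N = (Q * (?A * ?B) * P) ^\<^sub>m N"
      using pow_mat_direct_sum[of "T1 * ?U1" n1 "T2 * ?U2" n2 N] T(1) T2' U by auto
    also have "\<dots> = Q * (?A * ?B) ^\<^sub>m N * P" by (rule pow_mat_conjugate[OF _ P]) (use AB in auto)
    also have "\<dots> = 0\<^sub>m n1 n1 \<oplus>\<^sub>m 0\<^sub>m n2 n2" unfolding nil using P' n by (simp add: mult_zero_left_dim mult_zero_right_dim)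
    finally have "(T1 * ?U1) ^\<^sub>m N \<oplus>\<^sub>m (T2 * ?U2) ^\<^sub>m N = 0\<^sub>m n1 n1 \<oplus>\<^sub>m 0\<^sub>m n2 n2" .
    moreover have "(T1 * ?U1) ^\<^sub>m N \<in> carrier_mat n1 n1" "(T2 * ?U2) ^\<^sub>m N \<in> carrier_mat n2 n2"
      using T(1) T2' U by (auto intro!: pow_carrier_mat)
    ultimately have TU: "(T2 * ?U2) ^\<^sub>m N = 0\<^sub>m n2 n2" by (subst (asm) direct_sum_inject) auto
    have "R2 * T2 = T2 * R2"
      using poly_mat_intertwine[of S2 n2 S2 n2 R2 p] S12 R12 mutually_inverseD[OF SR2] unfolding TS by simp
    then have "T2 * ?U2 = ?U2 * T2" using poly_mat_intertwine[of R2 n2 R2 n2 T2 p] R12(3) T2' by simp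
    then have "T2 ^\<^sub>m N * ?U2 ^\<^sub>m N = 0\<^sub>m n2 n2" using pow_mat_mult_commuting[OF T2'(1) U(2), of N] TU by simp
    then have "W ^\<^sub>m N * (T2 ^\<^sub>m N * ?U2 ^\<^sub>m N) = W ^\<^sub>m N * 0\<^sub>m n2 n2" by simp
    moreover have "W ^\<^sub>m N * T2 ^\<^sub>m N = 1\<^sub>m n2 ^\<^sub>m N"
      using pow_mat_mult_commuting[OF T2'(2,1), of N] T2' by simp
    then have "W ^\<^sub>m N * T2 ^\<^sub>m N = 1\<^sub>m n2" by (simp add: pow_mat_one)
    then have "W ^\<^sub>m N * (T2 ^\<^sub>m N * ?U2 ^\<^sub>m N) = ?U2 ^\<^sub>m N"
      using T2' U(2) by (simp add: mult_one_left_dim flip: mult_assoc_dim)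
    ultimately show ?thesis using T2' by (simp add: mult_zero_right_dim)
  qed
  \<comment> \<open>The diagonal blocks of the form intertwine a nilpotent and an invertible operator, hence vanish.\<close>
  let ?M = "P\<^sup>T * M * P"
  have Mc: "?M \<in> carrier_mat (n1 + n2) (n1 + n2)" using P' M n by auto
  from block_split[OF Mc] obtain M11 M12 M21 M22 where Me: "?M = four_block_mat M11 M12 M21 M22"
    and Mb: "M11 \<in> carrier_mat n1 n1" "M12 \<in> carrier_mat n1 n2" "M21 \<in> carrier_mat n2 n1" "M22 \<in> carrier_mat n2 n2" .
  have "(Q * ?A * P)\<^sup>T * ?M = P\<^sup>T * (?A\<^sup>T * M) * P"
    using P' AB M mutually_inverse_cancel[OF mutually_inverse_transpose[OF P]] by (simp add: block_simps)
  also have "\<dots> = ?M * (Q * ?B * P)"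
    unfolding poly_isometry_adjoint(1)[OF M SR iso] using P' AB M mutually_inverse_cancel[OF P] by (simp add: block_simps)
  finally have "(T1\<^sup>T \<oplus>\<^sub>m T2\<^sup>T) * ?M = ?M * (?U1 \<oplus>\<^sub>m ?U2)" unfolding T(4) QB by (simp add: direct_sum_transpose)
  then have "M11 * ?U1 = T1\<^sup>T * M11" "M22 * ?U2 = T2\<^sup>T * M22"
    unfolding Me direct_sum_mat_def using T T2' U Mb by (simp_all add: block_simps)
  moreover have "(T1\<^sup>T) ^\<^sub>m K = 0\<^sub>m n1 n1" using pow_mat_transpose[OF T(1), of K] T(2) by simp
  ultimately have "M11 = 0\<^sub>m n1 n1" "M22 = 0\<^sub>m n2 n2"
    using intertwiner_invertible_nilpotent_zero[OF Mb(1) V, of "T1\<^sup>T" K] T(1)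
      intertwiner_nilpotent_invertible_zero[OF Mb(4) mutually_inverse_transpose[OF T(3)] U(2) U2nil] by auto
  then have "?M = four_block_mat (0\<^sub>m n1 n1) M12 M21 (0\<^sub>m n2 n2)" using Me by simp
  then have n12: "n1 = n2"
    using odd_summand_hyperbolic[OF Mb(2,3)] odd_summand_congruent[OF M P] no by metis
  obtain m1 where m1: "n1 = degree p * m1" "det S1 = ((-1) ^ degree p * coeff p 0) ^ m1"
    using det_of_primary_mat[OF S12(2) prime monic, of K] T(2) unfolding TS by blast
  obtain m2 where m2: "n2 = degree p * m2" "det R2 = ((-1) ^ degree p * coeff p 0) ^ m2"
    using det_of_primary_mat[OF R12(3) prime monic U2nil] by blast
  have "m1 = m2" using m1(1) m2(1) n12 degree_pos by simp
  have "det S = det (S1 \<oplus>\<^sub>m S2)" using det_conjugate[OF SR'(1) P] unfolding S12(1) by simp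
  also have "\<dots> = det R2 * det S2" using S12 m1(2) m2(2) \<open>m1 = m2\<close> by (simp add: det_direct_sum)
  also have "\<dots> = 1" using mutually_inverse_unique_det[OF SR2] by (simp add: mult.commute)
  finally show ?thesis .
qed

end

text \<open>The operator \<open>E = p(S) p(R)\<close> is self-adjoint, commutes with \<open>S\<close> and is singular. Its Fitting decomposition is orthogonal and invariant under \<open>S\<close>,
  so induction applies to the two parts unless \<open>E\<close> is nilpotent. In the nilpotent case the kernels of \<open>p(S)\<close> and \<open>p(R)\<close> either
  meet or not, which are the two preceding lemmas.\<close>

lemma isometry_det_one:
  fixes M :: "'a :: field mat"
  assumes "M \<in> carrier_mat n n" "mutually_inverse n S R" "S\<^sup>T * M * S = M" "\<not> odd_summand M"
  shows "det S = 1"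
  using assms
proof (induction n arbitrary: M S R rule: less_induct)
  case (less n)
  note M = less.prems(1) and SR = less.prems(2) and iso = less.prems(3) and no = less.prems(4)
  note SR' = mutually_inverseD[OF SR]
  show ?case
  proof (cases "n = 0")
    case True
    then show ?thesis using SR'(1) by simp
  next
    case False
    then obtain p where p: "minimal_singular_poly n S R p" using minimal_singular_poly_exists[OF SR] by auto
    interpret minimal_singular_poly n S R p by (rule p)
    let ?A = "poly_mat p S" and ?B = "poly_mat p R"
    have AB: "?A \<in> carrier_mat n n" "?B \<in> carrier_mat n n" using SR' by (auto intro: poly_mat_carrier)
    let ?E = "?A * ?B"
    have E: "?E \<in> carrier_mat n n" using AB by auto
    have RA: "?A * R = R * ?A" using poly_mat_intertwine[of S n S n R p] SR' by simp
    then have BA: "?B * ?A = ?A * ?B" using poly_mat_intertwine[of R n R n ?A p] SR' AB by simp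
    have "?E\<^sup>T * M = ?B\<^sup>T * (?A\<^sup>T * M)" using AB M by (simp add: block_simps)
    also have "\<dots> = (?B\<^sup>T * M) * ?B" unfolding poly_isometry_adjoint(1)[OF M SR iso] using AB M by (simp add: mult_assoc_dim)
    also have "\<dots> = M * ?E" unfolding poly_isometry_adjoint(2)[OF M SR iso] using AB M by (simp add: mult_assoc_dim)
    finally have adj: "?E\<^sup>T * M = M * ?E" .
    have "?A * S = S * ?A" using poly_mat_intertwine[of S n S n S p] SR' by simp
    moreover have "?B * S = S * ?B" using poly_mat_intertwine[of R n R n S p] SR' by simp
    ultimately have comm: "S * ?E = ?E * S" using commuting_mult[OF SR'(1) AB] by simp
    obtain P Q n1 n2 T1 T2 N W where P: "mutually_inverse n P Q" and n: "n = n1 + n2"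
      and T: "T1 \<in> carrier_mat n1 n1" "T1 ^\<^sub>m N = 0\<^sub>m n1 n1" "mutually_inverse n2 T2 W" "Q * ?E * P = T1 \<oplus>\<^sub>m T2"
      using fitting_decomposition[OF E] by blast
    note P' = mutually_inverseD[OF P] and T2' = mutually_inverseD[OF T(3)]
    from fitting_splits_commuting[OF E SR'(1) comm P n T] obtain S1 S2 where
      S12: "Q * S * P = S1 \<oplus>\<^sub>m S2" "S1 \<in> carrier_mat n1 n1" "S2 \<in> carrier_mat n2 n2" .
    from fitting_splits_bilinear_form[OF E M adj P n T] obtain M1 M2 where
      M12: "P\<^sup>T * M * P = M1 \<oplus>\<^sub>m M2" "M1 \<in> carrier_mat n1 n1" "M2 \<in> carrier_mat n2 n2" .
    have "n1 \<noteq> 0"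
    proof
      assume n1: "n1 = 0"
      obtain x where x: "x \<in> carrier_mat n 1" "x \<noteq> 0\<^sub>m n 1" "?A * x = 0\<^sub>m n 1" using singular by blast
      have "?E * x = ?B * (?A * x)" unfolding BA[symmetric] using AB x by (simp add: mult_assoc_dim)
      then have Ex: "?E * x = 0\<^sub>m n 1" using x AB by (simp add: mult_zero_right_dim)
      have "T1 \<oplus>\<^sub>m T2 = T2" using T(1) T2' n1 by (intro eq_matI) (auto simp: direct_sum_mat_def)
      then have T2e: "Q * ?E * P = T2" using T(4) by simp
      have "T2 * (Q * x) = Q * (?E * x)"
        unfolding T2e[symmetric] using x P' AB mutually_inverse_cancel[OF P] by (simp add: mult_assoc_dim)
      then have "T2 * (Q * x) = 0\<^sub>m n 1" unfolding Ex using P' by (simp add: mult_zero_right_dim)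
      then have "W * (T2 * (Q * x)) = W * 0\<^sub>m n 1" by simp
      then have "Q * x = 0\<^sub>m n 1"
        using mutually_inverse_cancel(2)[OF T(3), of "Q * x"] P' T2' n n1 by (simp add: mult_zero_right_dim)
      then have "P * (Q * x) = P * 0\<^sub>m n 1" by simp
      then show False using mutually_inverse_cancel(1)[OF P, of x] x P' by (simp add: mult_zero_right_dim)
    qed
    show ?thesis
    proof (cases "n2 = 0")
      case False
      have "\<not> odd_summand (M1 \<oplus>\<^sub>m M2)" using odd_summand_congruent[OF M P] M12(1) no by auto
      then have "\<not> odd_summand M1" "\<not> odd_summand M2"
        using odd_summand_direct_sum_left[OF M12(2,3)] odd_summand_direct_sum_right[OF M12(2,3)] by blast+
      then have IH: "\<And>S R. mutually_inverse n1 S R \<Longrightarrow> S\<^sup>T * M1 * S = M1 \<Longrightarrow> det S = 1"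
        "\<And>S R. mutually_inverse n2 S R \<Longrightarrow> S\<^sup>T * M2 * S = M2 \<Longrightarrow> det S = 1"
        using less.IH[OF _ M12(2)] less.IH[OF _ M12(3)] n \<open>n1 \<noteq> 0\<close> False by auto
      have dS: "det (S1 \<oplus>\<^sub>m S2) = det S" using det_conjugate[OF SR'(1) P] unfolding S12(1) .
      have "(Q * S * P)\<^sup>T * (P\<^sup>T * M * P) * (Q * S * P) = P\<^sup>T * (S\<^sup>T * M * S) * P"
        using P' SR' M mutually_inverse_cancel[OF P] mutually_inverse_cancel[OF mutually_inverse_transpose[OF P]]
        by (simp add: block_simps)
      then have "(S1 \<oplus>\<^sub>m S2)\<^sup>T * (M1 \<oplus>\<^sub>m M2) * (S1 \<oplus>\<^sub>m S2) = M1 \<oplus>\<^sub>m M2" unfolding iso S12(1) M12(1) .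
      moreover have "det (S1 \<oplus>\<^sub>m S2) \<noteq> 0" unfolding dS using mutually_inverse_unique_det[OF SR] by auto
      ultimately have "det (S1 \<oplus>\<^sub>m S2) = 1" 
        using M12(2,3) S12(2,3) by (intro isometry_direct_sum_det[of n1 M1 n2 M2]) (blast intro: IH)+
      then show ?thesis using dS by simp
    next
      case True
      have "T1 \<oplus>\<^sub>m T2 = T1" using T(1) T2' True by (intro eq_matI) (auto simp: direct_sum_mat_def)
      then have "(Q * ?E * P) ^\<^sub>m N = 0\<^sub>m n n" using T n True by simp
      then have "Q * ?E ^\<^sub>m N * P = 0\<^sub>m n n" using pow_mat_conjugate[OF E P, of N] by simp
      then have "P * (Q * ?E ^\<^sub>m N * P) * Q = P * 0\<^sub>m n n * Q" by simp
      moreover have "P * (Q * ?E ^\<^sub>m N * P) * Q = ?E ^\<^sub>m N"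
        using P' AB mutually_inverse_cancel[OF P] by (simp add: mult_assoc_dim mult_one_right_dim)
      ultimately have nil: "?E ^\<^sub>m N = 0\<^sub>m n n" using P' by (simp add: mult_zero_left_dim mult_zero_right_dim)
      have "even n" using odd_size_odd_summand[OF M] no by blast
      then show ?thesis
        using det_of_self_reciprocal[OF _ _ _ _ nil] det_of_isotropic_splitting[OF M iso nil _ no] by blast
    qed
  qed
qed

section \<open>Isometries of determinant one and odd summands\<close>

theorem theorem1:
  fixes M :: "'a :: field mat" and n :: nat
  assumes "CHAR('a) \<noteq> 2"
    and "M \<in> carrier_mat n n"
  shows "(\<forall>S \<in> carrier_mat n n. invertible_mat S \<longrightarrow> S\<^sup>T * M * S = M \<longrightarrow> det S = 1) \<longleftrightarrow>
    \<not> (\<exists>k m A B. odd k \<and> A \<in> carrier_mat k k \<and> B \<in> carrier_mat m m \<and>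
        congruent_mat M (A \<oplus>\<^sub>m B))"
  unfolding odd_summand_def[symmetric]
proof
  assume all: "\<forall>S \<in> carrier_mat n n. invertible_mat S \<longrightarrow> S\<^sup>T * M * S = M \<longrightarrow> det S = 1"
  note M = assms(2)
  show "\<not> odd_summand M"
  proof
    assume "odd_summand M"
    from odd_summandE[OF this M] obtain P Q A B k m where P: "mutually_inverse n P Q" and e: "P\<^sup>T * M * P = A \<oplus>\<^sub>m B"
      and AB: "A \<in> carrier_mat k k" "B \<in> carrier_mat m m" "odd k" and n: "n = k + m" .
    note P' = mutually_inverseD[OF P]
    \<comment> \<open>minus the identity on the odd summand, the identity on its orthogonal complement\<close>
    let ?I = "(- 1) \<cdot>\<^sub>m 1\<^sub>m k :: 'a mat"
    define J where "J = ?I \<oplus>\<^sub>m 1\<^sub>m m"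
    let ?S = "P * J * Q"
    have J: "J \<in> carrier_mat n n" using n by (auto simp: J_def)
    have II: "?I * ?I = 1\<^sub>m k" by (intro eq_matI) (auto simp: smult_left_dim smult_right_dim)
    have "J * J = 1\<^sub>m n" using II n by (simp add: J_def direct_sum_mult)
    then have JJ: "mutually_inverse n J J" using J by (simp add: mutually_inverse_def)
    have S: "mutually_inverse n ?S (P * (J * Q))"
      by (intro mutually_inverse_mult P JJ mutually_inverse_sym[OF P])
    have "?I\<^sup>T = ?I" by (intro eq_matI) auto
    moreover have "(- 1) \<cdot>\<^sub>m ((- 1) \<cdot>\<^sub>m A) = A" by (intro eq_matI) auto
    then have "?I * A * ?I = A"
      using AB by (simp add: smult_left_dim smult_right_dim mult_one_left_dim mult_one_right_dim)
    ultimately have JMJ: "J\<^sup>T * (A \<oplus>\<^sub>m B) * J = A \<oplus>\<^sub>m B"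
      using AB by (simp add: J_def direct_sum_transpose direct_sum_mult mult_one_left_dim mult_one_right_dim)
    have "?S\<^sup>T * M * ?S = Q\<^sup>T * (J\<^sup>T * (P\<^sup>T * M * P) * J) * Q"
      using P' J assms(2) by (simp add: transpose_mult_dim mult_assoc_dim)
    also have "\<dots> = Q\<^sup>T * (P\<^sup>T * M * P) * Q" unfolding e JMJ ..
    also have "\<dots> = M"
      using P' M mutually_inverse_cancel[OF P] mutually_inverse_cancel[OF mutually_inverse_transpose[OF P]]
      by (simp add: mult_assoc_dim mult_one_right_dim)
    finally have "?S\<^sup>T * M * ?S = M" .
    moreover have Sc: "?S \<in> carrier_mat n n" using mutually_inverseD[OF S] by blast
    moreover have "invertible_mat ?S" using invertible_mat_iff_mutually_inverse[OF Sc] S by blast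
    ultimately have "det ?S = 1" using all by blast
    moreover have "det ?S = det J" by (rule det_conjugate[OF J mutually_inverse_sym[OF P]])
    moreover have "det J = (- 1) ^ k" by (simp add: J_def det_direct_sum[of _ k _ m] det_smult)
    ultimately have "(- 1 :: 'a) = 1" using AB(3) by simp
    then have "(2 :: 'a) = 0" by (metis add.right_inverse one_add_one)
    then have "of_nat 2 = (0 :: 'a)" by simp
    then have "CHAR('a) dvd 2" by (simp only: of_nat_eq_0_iff_char_dvd)
    moreover have "CHAR('a) \<noteq> 1" by simp
    ultimately show False using assms(1) by (metis prime_nat_iff two_is_prime_nat)
  qed
next
  assume no: "\<not> odd_summand M"
  show "\<forall>S \<in> carrier_mat n n. invertible_mat S \<longrightarrow> S\<^sup>T * M * S = M \<longrightarrow> det S = 1"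
    using isometry_det_one[OF assms(2) _ _ no] invertible_mat_iff_mutually_inverse by blast
qed

end
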